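(* Let $T$ be a random time and $\nu$ a probability measure on $\mathbb{R}$. Then $T$ is an unbiased shift embedding $\nu$ if and only if the allocation rule $\tau_T$ defined by $\tau_T(t):=T\circ\theta_t+t$, $t\in\mathbb{R}$, balances $\ell^0$ and $\ell^\nu$.
   Context: Let $\Omega$ be the set of continuous functions $\omega:\mathbb{R}\to\mathbb{R}$ with the Kolmogorov product $\sigma$-algebra $\mathcal{A}$, let $B=(B_t)_{t\in\mathbb{R}}$ be the identity (coordinate process) on $\Omega$, and let $\mathbb{P}_0$ be the law of a two-sided standard Brownian motion with $B_0=0$. Put $\mathbb{P}_x:=\mathbb{P}_0\{B+x\in\cdot\}$ for $x\in\mathbb{R}$, $\mathbb{P}:=\int\mathbb{P}_x\,dx$ (a $\sigma$-finite measure on $\Omega$), and $(\theta_t\omega)_s:=\omega_{t+s}$ for $s,t\in\mathbb{R}$. Random times. A random time is a measurable map $T:\Omega\to\mathbb{R}$. $T$ is an unbiased shift if, under $\mathbb{P}_0$, $(B_{T+t}-B_T)_{t\in\mathbb{R}}$ is a two-sided standard Brownian motion independent of $B_T$. $T$ embeds $\nu$ if $B_T$ has distribution $\nu$ under $\mathbb{P}_0$. Local times. $\ell^x$ denotes the random measure on $\mathbb{R}$ associated with the local time of $B$ at $x\in\mathbb{R}$: for all measurable $f:\mathbb{R}^2\to[0,\infty)$, $\int f(B_s,s)\,ds=\iint f(x,s)\,\ell^x(ds)\,dx$, $\mathbb{P}_0$-a.s. A version is fixed such that: $\ell^0$ is $\mathbb{P}_x$-a.e. diffuse (atomless) for every $x$;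 $\ell^0(\theta_t\omega,C-t)=\ell^0(\omega,C)$ for all Borel $C\subset\mathbb{R}$ and $t\in\mathbb{R}$, $\mathbb{P}_x$-a.s. for every $x$; $\ell^y(\omega,\cdot)=\ell^0(\omega-y,\cdot)$ for all $\omega,y$; and $\int \mathbf{1}\{B_t\neq x\}\,\ell^x(\omega,dt)=0$ for all $\omega,x$. For a locally finite measure $\nu$ on $\mathbb{R}$, $\ell^\nu(\omega,\cdot):=\int\ell^x(\omega,\cdot)\,\nu(dx)$. Allocation rules. An allocation rule is a measurable map $\tau:\Omega\times\mathbb{R}\to\mathbb{R}$ with $\tau(\theta_t\omega,s-t)=\tau(\omega,s)-t$ for all $s,t\in\mathbb{R}$ and $\mathbb{P}$-a.e. $\omega$; we write $\tau(s)=\tau(\cdot,s)$. It balances random measures $\xi$ and $\eta$ on $\mathbb{R}$ if $\int\mathbf{1}\{\tau(s)\in\cdot\}\,\xi(ds)=\eta$, $\mathbb{P}$-a.e. *)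

theory Defs
  imports "HOL-Probability.Probability"
begin

section \<open>Canonical path space\<close>

definition path_space :: "(real \<Rightarrow> real) measure" where
  "path_space = restrict_space (\<Pi>\<^sub>M t\<in>UNIV. borel) {\<omega>. continuous_on UNIV \<omega>}"

definition path_shift :: "real \<Rightarrow> (real \<Rightarrow> real) \<Rightarrow> real \<Rightarrow> real" where
  "path_shift t \<omega> = (\<lambda>s. \<omega> (t + s))"

lemma space_path_space: "space path_space = {\<omega>. continuous_on UNIV \<omega>}"
  by (auto simp: path_space_def space_restrict_space space_PiM)

lemma measurable_into_path_space:
  assumes "\<And>a. a \<in> space M \<Longrightarrow> continuous_on UNIV (X a)"
    and "\<And>t. (\<lambda>a. X a t) \<in> borel_measurable M"
  shows "X \<in> M \<rightarrow>\<^sub>M path_space"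
  unfolding path_space_def
proof (rule measurable_restrict_space2)
  show "X \<in> space M \<rightarrow> {\<omega>. continuous_on UNIV \<omega>}"
    using assms(1) by auto
  have "(\<lambda>a. \<lambda>t\<in>UNIV. X a t) \<in> M \<rightarrow>\<^sub>M (\<Pi>\<^sub>M t\<in>UNIV. borel)"
    by (rule measurable_restrict) (use assms(2) in auto)
  then show "X \<in> M \<rightarrow>\<^sub>M (\<Pi>\<^sub>M t\<in>UNIV. borel)"
    by (simp add: restrict_UNIV)
qed

lemma measurable_path_eval: "(\<lambda>\<omega>. \<omega> t) \<in> borel_measurable path_space"
  unfolding path_space_def
  by (rule measurable_restrict_space1) (rule measurable_component_singleton, simp)


section \<open>Mixtures of measures\<close>

text \<open>
  The measure \<open>A \<mapsto> \<integral> K x A \<mu>(dx)\<close> on \<open>N\<close>. The monadic bind of the library is not used because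
  its kernels must be sub-probability kernels, which local times are not.
\<close>

definition mixture :: "'a measure \<Rightarrow> 'b measure \<Rightarrow> ('a \<Rightarrow> 'b measure) \<Rightarrow> 'b measure" where
  "mixture \<mu> N K = measure_of (space N) (sets N) (\<lambda>A. \<integral>\<^sup>+ x. emeasure (K x) A \<partial>\<mu>)"

lemma sets_mixture [simp]: "sets (mixture \<mu> N K) = sets N"
  by (simp add: mixture_def)

lemma space_mixture [simp]: "space (mixture \<mu> N K) = space N"
  by (simp add: mixture_def)

lemma emeasure_mixture:
  assumes sets: "\<And>x. x \<in> space \<mu> \<Longrightarrow> sets (K x) = sets N"
    and meas: "\<And>A. A \<in> sets N \<Longrightarrow> (\<lambda>x. emeasure (K x) A) \<in> borel_measurable \<mu>"
    and A: "A \<in> sets N"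
  shows "emeasure (mixture \<mu> N K) A = (\<integral>\<^sup>+ x. emeasure (K x) A \<partial>\<mu>)"
proof (rule emeasure_measure_of[OF mixture_def])
  show "sets N \<subseteq> Pow (space N)" by (rule sets.space_closed)
  show "A \<in> sets (mixture \<mu> N K)" using A by simp
  show "positive (sets (mixture \<mu> N K)) (\<lambda>A. \<integral>\<^sup>+ x. emeasure (K x) A \<partial>\<mu>)"
    by (simp add: positive_def)
  show "countably_additive (sets (mixture \<mu> N K)) (\<lambda>A. \<integral>\<^sup>+ x. emeasure (K x) A \<partial>\<mu>)"
  proof (rule countably_additiveI)
    fix F :: "nat \<Rightarrow> _"
    assume F: "range F \<subseteq> sets (mixture \<mu> N K)" "disjoint_family F"
    have "(\<Sum>i. \<integral>\<^sup>+ x. emeasure (K x) (F i) \<partial>\<mu>) = (\<integral>\<^sup>+ x. (\<Sum>i. emeasure (K x) (F i)) \<partial>\<mu>)"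
      by (rule nn_integral_suminf[symmetric]) (use F meas in auto)
    also have "\<dots> = (\<integral>\<^sup>+ x. emeasure (K x) (\<Union>i. F i) \<partial>\<mu>)"
      by (rule nn_integral_cong, rule suminf_emeasure) (use F sets in auto)
    finally show "(\<Sum>i. \<integral>\<^sup>+ x. emeasure (K x) (F i) \<partial>\<mu>) = (\<integral>\<^sup>+ x. emeasure (K x) (\<Union>i. F i) \<partial>\<mu>)" .
  qed
qed


section \<open>Two-sided Brownian motion\<close>

text \<open>
  Two-sided Brownian motion is taken as the continuous process on the whole line that vanishes at
  time 0 and has independent increments, the one over \<open>[s, t]\<close> being centred normal with variance
  \<open>t - s\<close>. The second parameter of \<^const>\<open>normal_density\<close> is the standard deviation.
\<close>

definition two_sided_BM :: "'a measure \<Rightarrow> ('a \<Rightarrow> real \<Rightarrow> real) \<Rightarrow> bool" where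
  "two_sided_BM M X \<longleftrightarrow>
     prob_space M \<and>
     (\<forall>t. (\<lambda>a. X a t) \<in> borel_measurable M) \<and>
     (\<forall>a\<in>space M. continuous_on UNIV (X a)) \<and>
     (AE a in M. X a 0 = 0) \<and>
     (\<forall>s t. s < t \<longrightarrow>
        distributed M lborel (\<lambda>a. X a t - X a s) (normal_density 0 (sqrt (t - s)))) \<and>
     (\<forall>(n::nat) (t::nat \<Rightarrow> real). (\<forall>i<n. t i < t (Suc i)) \<longrightarrow>
        prob_space.indep_vars M (\<lambda>_. borel) (\<lambda>i a. X a (t (Suc i)) - X a (t i)) {..<n})"

definition brownian_law :: "(real \<Rightarrow> real) measure \<Rightarrow> bool" where
  "brownian_law P0 \<longleftrightarrow> sets P0 = sets path_space \<and> two_sided_BM P0 (\<lambda>\<omega>. \<omega>)"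

definition law_from :: "(real \<Rightarrow> real) measure \<Rightarrow> real \<Rightarrow> (real \<Rightarrow> real) measure" where
  "law_from P0 x = distr P0 path_space (\<lambda>\<omega> t. \<omega> t + x)"

definition stationary_law :: "(real \<Rightarrow> real) measure \<Rightarrow> (real \<Rightarrow> real) measure" where
  "stationary_law P0 = mixture lborel path_space (law_from P0)"

lemma emeasure_stationary_law:
  assumes P0: "brownian_law P0" and A: "A \<in> sets path_space"
  shows "emeasure (stationary_law P0) A = (\<integral>\<^sup>+ x. emeasure (law_from P0 x) A \<partial>lborel)"
  unfolding stationary_law_def
proof (rule emeasure_mixture[OF _ _ A])
  show "sets (law_from P0 x) = sets path_space" for x by (simp add: law_from_def)
  fix A assume A: "A \<in> sets path_space"
  interpret prob_space P0 using P0 by (simp add: brownian_law_def two_sided_BM_def)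
  have S: "sets P0 = sets path_space" using P0 by (simp add: brownian_law_def)
  have [measurable]: "(\<lambda>\<omega>. \<omega> t) \<in> borel_measurable P0" for t
    using measurable_path_eval measurable_cong_sets[OF S refl] by blast
  have m: "(\<lambda>p t. snd p t + fst p) \<in> borel \<Otimes>\<^sub>M P0 \<rightarrow>\<^sub>M path_space"
    by (rule measurable_into_path_space)
      (auto simp: space_pair_measure sets_eq_imp_space_eq[OF S] space_path_space
            intro!: continuous_intros)
  have mx: "(\<lambda>\<omega> t. \<omega> t + x) \<in> P0 \<rightarrow>\<^sub>M path_space" for x
    by (rule measurable_into_path_space)
      (auto simp: sets_eq_imp_space_eq[OF S] space_path_space intro!: continuous_intros)
  have "(\<lambda>x. emeasure P0 (Pair x -` ((\<lambda>p t. snd p t + fst p) -` A \<inter> space (borel \<Otimes>\<^sub>M P0))))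
          \<in> borel_measurable borel"
    by (rule measurable_emeasure_Pair) (rule measurable_sets[OF m A])
  also have "(\<lambda>x. emeasure P0 (Pair x -` ((\<lambda>p t. snd p t + fst p) -` A \<inter> space (borel \<Otimes>\<^sub>M P0))))
      = (\<lambda>x. emeasure (law_from P0 x) A)"
    by (auto simp: fun_eq_iff law_from_def emeasure_distr[OF mx A] space_pair_measure
             intro!: arg_cong[where f = "emeasure P0"])
  finally show "(\<lambda>x. emeasure (law_from P0 x) A) \<in> borel_measurable lborel" by simp
qed


section \<open>Random measures, local times and allocation rules\<close>

definition random_measure ::
  "(real \<Rightarrow> real) measure \<Rightarrow> ((real \<Rightarrow> real) \<Rightarrow> real measure) \<Rightarrow> bool" where
  "random_measure P \<xi> \<longleftrightarrow>
     (\<forall>\<omega>\<in>space path_space. sets (\<xi> \<omega>) = sets borel) \<and>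
     (\<forall>C\<in>sets borel. (\<lambda>\<omega>. emeasure (\<xi> \<omega>) C) \<in> borel_measurable path_space) \<and>
     (AE \<omega> in P. \<forall>K. compact K \<longrightarrow> emeasure (\<xi> \<omega>) K < \<infinity>)"

text \<open>
  \<open>local_time P0 l\<close>: the family \<open>l x \<omega>\<close> is a version of the local time of the coordinate process
  with the regularity properties usually fixed (diffuse, shift-covariant outside one null set for
  all times and Borel sets, covariant in the level and carried by the level set).
\<close>

definition local_time ::
  "(real \<Rightarrow> real) measure \<Rightarrow> (real \<Rightarrow> (real \<Rightarrow> real) \<Rightarrow> real measure) \<Rightarrow> bool" where
  "local_time P0 l \<longleftrightarrow>
     (\<forall>x. random_measure (stationary_law P0) (l x)) \<and>
     (\<forall>f :: real \<times> real \<Rightarrow> real. f \<in> borel_measurable borel \<longrightarrow> (\<forall>z. 0 \<le> f z) \<longrightarrow>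
        (AE \<omega> in P0. (\<integral>\<^sup>+ s. f (\<omega> s, s) \<partial>lborel) =
                     (\<integral>\<^sup>+ x. (\<integral>\<^sup>+ s. f (x, s) \<partial>l x \<omega>) \<partial>lborel))) \<and>
     (\<forall>x. AE \<omega> in law_from P0 x. \<forall>s. emeasure (l 0 \<omega>) {s} = 0) \<and>
     (\<forall>x. AE \<omega> in law_from P0 x. \<forall>t. \<forall>C\<in>sets borel.
        emeasure (l 0 (path_shift t \<omega>)) ((\<lambda>s. s - t) ` C) = emeasure (l 0 \<omega>) C) \<and>
     (\<forall>\<omega>\<in>space path_space. \<forall>y. l y \<omega> = l 0 (\<lambda>s. \<omega> s - y)) \<and>
     (\<forall>\<omega>\<in>space path_space. \<forall>x. (\<integral>\<^sup>+ t. indicator {t. \<omega> t \<noteq> x} t \<partial>l x \<omega>) = 0)"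

definition local_time_mix ::
  "(real \<Rightarrow> (real \<Rightarrow> real) \<Rightarrow> real measure) \<Rightarrow> real measure \<Rightarrow> (real \<Rightarrow> real) \<Rightarrow> real measure" where
  "local_time_mix l \<nu> \<omega> = mixture \<nu> borel (\<lambda>x. l x \<omega>)"

lemma emeasure_local_time_mix:
  assumes l: "local_time P0 l" and \<omega>: "\<omega> \<in> space path_space"
    and \<nu>: "sets \<nu> = sets borel" and C: "C \<in> sets borel"
  shows "emeasure (local_time_mix l \<nu> \<omega>) C = (\<integral>\<^sup>+ x. emeasure (l x \<omega>) C \<partial>\<nu>)"
  unfolding local_time_mix_def
proof (rule emeasure_mixture[OF _ _ C])
  have rm: "random_measure (stationary_law P0) (l x)" for x
    using l by (simp add: local_time_def)
  then show "sets (l x \<omega>) = sets borel" for x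
    using \<omega> by (simp add: random_measure_def)
  fix C :: "real set" assume C: "C \<in> sets borel"
  have shift: "(\<lambda>y s. \<omega> s - y) \<in> borel \<rightarrow>\<^sub>M path_space"
    using \<omega> by (intro measurable_into_path_space)
      (auto simp: space_path_space intro!: continuous_intros)
  have "(\<lambda>y. emeasure (l 0 (\<lambda>s. \<omega> s - y)) C) \<in> borel_measurable borel"
    using measurable_compose[OF shift, of "\<lambda>\<omega>. emeasure (l 0 \<omega>) C" borel] rm[of 0] C
    by (simp add: random_measure_def)
  moreover have "l y \<omega> = l 0 (\<lambda>s. \<omega> s - y)" for y
    using l \<omega> by (simp add: local_time_def)
  ultimately show "(\<lambda>x. emeasure (l x \<omega>) C) \<in> borel_measurable \<nu>"
    by (subst measurable_cong_sets[OF \<nu> refl]) simp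
qed

definition allocation_rule ::
  "(real \<Rightarrow> real) measure \<Rightarrow> ((real \<Rightarrow> real) \<Rightarrow> real \<Rightarrow> real) \<Rightarrow> bool" where
  "allocation_rule P \<tau> \<longleftrightarrow>
     (\<lambda>(\<omega>, s). \<tau> \<omega> s) \<in> borel_measurable (path_space \<Otimes>\<^sub>M borel) \<and>
     (AE \<omega> in P. \<forall>s t. \<tau> (path_shift t \<omega>) (s - t) = \<tau> \<omega> s - t)"

definition balances ::
  "(real \<Rightarrow> real) measure \<Rightarrow> ((real \<Rightarrow> real) \<Rightarrow> real \<Rightarrow> real) \<Rightarrow>
   ((real \<Rightarrow> real) \<Rightarrow> real measure) \<Rightarrow> ((real \<Rightarrow> real) \<Rightarrow> real measure) \<Rightarrow> bool" where
  "balances P \<tau> \<xi> \<eta> \<longleftrightarrow> (AE \<omega> in P. distr (\<xi> \<omega>) borel (\<tau> \<omega>) = \<eta> \<omega>)"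


section \<open>Random times and unbiased shifts\<close>

text \<open>
  Independence of two random variables with values of different types;
  \<^const>\<open>prob_space.indep_var\<close> requires a common type of values.
\<close>

definition indep_rvs ::
  "'a measure \<Rightarrow> 'b measure \<Rightarrow> ('a \<Rightarrow> 'b) \<Rightarrow> 'c measure \<Rightarrow> ('a \<Rightarrow> 'c) \<Rightarrow> bool" where
  "indep_rvs M S X N Y \<longleftrightarrow>
     X \<in> M \<rightarrow>\<^sub>M S \<and> Y \<in> M \<rightarrow>\<^sub>M N \<and>
     prob_space.indep_set M {X -` A \<inter> space M |A. A \<in> sets S} {Y -` A \<inter> space M |A. A \<in> sets N}"

definition random_time :: "((real \<Rightarrow> real) \<Rightarrow> real) \<Rightarrow> bool" where
  "random_time T \<longleftrightarrow> T \<in> borel_measurable path_space"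

definition unbiased_shift ::
  "(real \<Rightarrow> real) measure \<Rightarrow> ((real \<Rightarrow> real) \<Rightarrow> real) \<Rightarrow> bool" where
  "unbiased_shift P0 T \<longleftrightarrow>
     two_sided_BM P0 (\<lambda>\<omega> t. \<omega> (T \<omega> + t) - \<omega> (T \<omega>)) \<and>
     indep_rvs P0 path_space (\<lambda>\<omega> t. \<omega> (T \<omega> + t) - \<omega> (T \<omega>)) borel (\<lambda>\<omega>. \<omega> (T \<omega>))"

definition embeds ::
  "(real \<Rightarrow> real) measure \<Rightarrow> ((real \<Rightarrow> real) \<Rightarrow> real) \<Rightarrow> real measure \<Rightarrow> bool" where
  "embeds P0 T \<nu> \<longleftrightarrow> distr P0 borel (\<lambda>\<omega>. \<omega> (T \<omega>)) = \<nu>"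

definition allocation_of :: "((real \<Rightarrow> real) \<Rightarrow> real) \<Rightarrow> (real \<Rightarrow> real) \<Rightarrow> real \<Rightarrow> real" where
  "allocation_of T \<omega> t = T (path_shift t \<omega>) + t"

end

theory Submission
  imports Defs
begin

text \<open>
  Under \<open>P = stationary_law P0\<close> the local time at level \<open>y\<close> has Palm measure \<open>law_from P0 y\<close>, that is,
  \<open>\<integral> \<integral> f (path_shift s \<omega>, s) l y \<omega> (ds) P(d\<omega>) = \<integral> \<integral> f (\<omega> + y, s) ds P0(d\<omega>)\<close>:
  after translating the path, this is the occupation time formula combined with the fact that
  \<open>\<omega> (s + \<sqdot>) - \<omega> s\<close> has law \<open>P0\<close>. Consequently the Palm measure of the mixture over \<open>\<nu>\<close> is the law
  of Brownian motion with initial distribution \<open>\<nu>\<close>, while transporting \<open>l 0\<close> by \<open>allocation_of T\<close>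
  gives the law of \<open>path_shift (T \<omega>) \<omega>\<close> under \<open>P0\<close> as Palm measure. A random measure of finite
  intensity is determined by its Palm measure up to null sets, so balancing means that these two
  laws agree. By uniqueness of the law of Brownian motion, they agree precisely when \<open>T\<close> is an
  unbiased shift embedding \<open>\<nu>\<close>.
\<close>

section \<open>Integration along kernels\<close>

text \<open>Averaging over \<open>P\<close> means spreading the starting point of \<open>P0\<close>
  by Lebesgue measure. The local time at 0 of a path lowered by \<open>x\<close> is the local time
  at level \<open>x\<close> of the path itself, so the integral over starting points becomes an
  integral over levels, which is the side of the occupation formula where local times stand. The
  obstacle is that this formula is assumed for one deterministic integrand at a time, with a null
  set that depends on it, whereas a Palm formula integrates functions of the path as well. It is
  therefore turned into an equality of two measures on triples of path, level and time, checked on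
  rectangles. In the converse direction, equality of two random measures is reduced to comparing,
  for each bounded interval, two densities with respect to \<open>P\<close>. That comparison needs a
  finite integral, which is available because the mixture of local times has Lebesgue measure as its
  intensity.\<close>

lemma measurable_eqI:
  assumes "g \<in> M \<rightarrow>\<^sub>M N" "\<And>w. w \<in> space M \<Longrightarrow> f w = g w"
  shows "f \<in> M \<rightarrow>\<^sub>M N"
  using assms measurable_cong[of M f g N] by simp

text \<open>Meant for kernels such as local times, whose mass is not bounded. The induction over
  nonnegative functions rests on linearity and monotone convergence, which hold for every measure,
  so setwise measurability of the kernel suffices.\<close>

lemma borel_measurable_nn_integral_kernel:
  assumes sets: "\<And>x. x \<in> space \<mu> \<Longrightarrow> sets (K x) = sets N"
    and meas: "\<And>A. A \<in> sets N \<Longrightarrow> (\<lambda>x. emeasure (K x) A) \<in> borel_measurable \<mu>"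
    and f: "f \<in> borel_measurable N"
  shows "(\<lambda>x. \<integral>\<^sup>+ y. f y \<partial>K x) \<in> borel_measurable \<mu>"
proof -
  have mK: "g \<in> borel_measurable (K x)" if "g \<in> borel_measurable N" "x \<in> space \<mu>" for g :: "_ \<Rightarrow> ennreal" and x
    using that(1) by (subst measurable_cong_sets[OF sets[OF that(2)] refl])
  show ?thesis using f
  proof (induction rule: borel_measurable_induct)
    case (cong f g)
    have "(\<integral>\<^sup>+ y. g y \<partial>K x) = (\<integral>\<^sup>+ y. f y \<partial>K x)" if "x \<in> space \<mu>" for x
      using cong(3) sets_eq_imp_space_eq[OF sets[OF that]] by (intro nn_integral_cong) simp
    then show ?case using measurable_eqI[OF cong(4)] by simp
  next
    case (set A)
    have "(\<integral>\<^sup>+ y. indicator A y \<partial>K x) = emeasure (K x) A" if "x \<in> space \<mu>" for x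
      using set sets[OF that] by simp
    then show ?case using measurable_eqI[OF meas[OF set]] by simp
  next
    case (mult u c)
    have "(\<integral>\<^sup>+ y. c * u y \<partial>K x) = c * (\<integral>\<^sup>+ y. u y \<partial>K x)" if "x \<in> space \<mu>" for x
      using mK[OF mult(2) that] by (rule nn_integral_cmult)
    moreover have "(\<lambda>x. c * (\<integral>\<^sup>+ y. u y \<partial>K x)) \<in> borel_measurable \<mu>"
      using mult(4) by measurable
    ultimately show ?case by (rule measurable_eqI[rotated])
  next
    case (add u v)
    have "(\<integral>\<^sup>+ y. v y + u y \<partial>K x) = (\<integral>\<^sup>+ y. v y \<partial>K x) + (\<integral>\<^sup>+ y. u y \<partial>K x)"
      if "x \<in> space \<mu>" for x
      using mK[OF \<open>v \<in> borel_measurable N\<close> that] mK[OF \<open>u \<in> borel_measurable N\<close> that] by (rule nn_integral_add)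
    moreover have "(\<lambda>x. (\<integral>\<^sup>+ y. v y \<partial>K x) + (\<integral>\<^sup>+ y. u y \<partial>K x)) \<in> borel_measurable \<mu>"
      using add.IH by measurable
    ultimately show ?case by (rule measurable_eqI[rotated])
  next
    case (seq U)
    have "(\<integral>\<^sup>+ y. (SUP i. U i y) \<partial>K x) = (SUP i. \<integral>\<^sup>+ y. U i y \<partial>K x)" if "x \<in> space \<mu>" for x
      using seq(3) mK[OF seq(1) that] by (intro nn_integral_monotone_convergence_SUP)
    moreover have "(\<lambda>x. SUP i. \<integral>\<^sup>+ y. U i y \<partial>K x) \<in> borel_measurable \<mu>"
      using seq.IH by measurable
    ultimately show ?case unfolding SUP_apply by (rule measurable_eqI[rotated])
  qed
qed

text \<open>The same induction; measurability of the inner integral lets the outer one pass through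
  multiples, sums and increasing limits.\<close>

lemma nn_integral_mixture:
  assumes sets: "\<And>x. x \<in> space \<mu> \<Longrightarrow> sets (K x) = sets N"
    and meas: "\<And>A. A \<in> sets N \<Longrightarrow> (\<lambda>x. emeasure (K x) A) \<in> borel_measurable \<mu>"
    and f: "f \<in> borel_measurable N"
  shows "(\<integral>\<^sup>+ y. f y \<partial>mixture \<mu> N K) = (\<integral>\<^sup>+ x. (\<integral>\<^sup>+ y. f y \<partial>K x) \<partial>\<mu>)"
proof -
  have mK: "g \<in> borel_measurable (K x)" if "g \<in> borel_measurable N" "x \<in> space \<mu>" for g :: "_ \<Rightarrow> ennreal" and x
    using that(1) by (subst measurable_cong_sets[OF sets[OF that(2)] refl])
  have mm: "g \<in> borel_measurable (mixture \<mu> N K)" if "g \<in> borel_measurable N" for g :: "_ \<Rightarrow> ennreal"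
    using measurable_cong_sets[of "mixture \<mu> N K" N] that by auto
  have mI: "(\<lambda>x. \<integral>\<^sup>+ y. g y \<partial>K x) \<in> borel_measurable \<mu>" if "g \<in> borel_measurable N" for g
    using sets meas that by (rule borel_measurable_nn_integral_kernel)
  show ?thesis using f
  proof (induction rule: borel_measurable_induct)
    case (cong f g)
    have "(\<integral>\<^sup>+ y. g y \<partial>K x) = (\<integral>\<^sup>+ y. f y \<partial>K x)" if "x \<in> space \<mu>" for x
      using cong(3) sets_eq_imp_space_eq[OF sets[OF that]] by (intro nn_integral_cong) simp
    moreover have "(\<integral>\<^sup>+ y. g y \<partial>mixture \<mu> N K) = (\<integral>\<^sup>+ y. f y \<partial>mixture \<mu> N K)"
      using cong(3) by (intro nn_integral_cong) simp
    ultimately show ?case using cong(4) by (simp cong: nn_integral_cong)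
  next
    case (set A)
    have "(\<integral>\<^sup>+ y. indicator A y \<partial>K x) = emeasure (K x) A" if "x \<in> space \<mu>" for x
      using set sets[OF that] by simp
    then show ?case using set emeasure_mixture[of \<mu> K N, OF sets meas set]
      by (simp cong: nn_integral_cong)
  next
    case (mult u c)
    have "(\<integral>\<^sup>+ y. c * u y \<partial>K x) = c * (\<integral>\<^sup>+ y. u y \<partial>K x)" if "x \<in> space \<mu>" for x
      using mK[OF mult(2) that] by (rule nn_integral_cmult)
    then have "(\<integral>\<^sup>+ x. \<integral>\<^sup>+ y. c * u y \<partial>K x \<partial>\<mu>) = (\<integral>\<^sup>+ x. c * (\<integral>\<^sup>+ y. u y \<partial>K x) \<partial>\<mu>)"
      by (rule nn_integral_cong)
    also have "\<dots> = c * (\<integral>\<^sup>+ x. \<integral>\<^sup>+ y. u y \<partial>K x \<partial>\<mu>)"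
      by (rule nn_integral_cmult[OF mI[OF mult(2)]])
    also have "\<dots> = (\<integral>\<^sup>+ y. c * u y \<partial>mixture \<mu> N K)"
      using mult.IH by (simp add: nn_integral_cmult[OF mm[OF mult(2)]])
    finally show ?case by simp
  next
    case (add u v)
    have "(\<integral>\<^sup>+ y. v y + u y \<partial>K x) = (\<integral>\<^sup>+ y. v y \<partial>K x) + (\<integral>\<^sup>+ y. u y \<partial>K x)"
      if "x \<in> space \<mu>" for x
      using mK[OF \<open>v \<in> borel_measurable N\<close> that] mK[OF \<open>u \<in> borel_measurable N\<close> that] by (rule nn_integral_add)
    then have "(\<integral>\<^sup>+ x. \<integral>\<^sup>+ y. v y + u y \<partial>K x \<partial>\<mu>) =
        (\<integral>\<^sup>+ x. (\<integral>\<^sup>+ y. v y \<partial>K x) + (\<integral>\<^sup>+ y. u y \<partial>K x) \<partial>\<mu>)"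
      by (rule nn_integral_cong)
    also have "\<dots> = (\<integral>\<^sup>+ x. \<integral>\<^sup>+ y. v y \<partial>K x \<partial>\<mu>) + (\<integral>\<^sup>+ x. \<integral>\<^sup>+ y. u y \<partial>K x \<partial>\<mu>)"
      by (rule nn_integral_add[OF mI[OF \<open>v \<in> borel_measurable N\<close>] mI[OF \<open>u \<in> borel_measurable N\<close>]])
    also have "\<dots> = (\<integral>\<^sup>+ y. v y + u y \<partial>mixture \<mu> N K)"
      using add.IH by (simp add: nn_integral_add[OF mm[OF \<open>v \<in> borel_measurable N\<close>] mm[OF \<open>u \<in> borel_measurable N\<close>]])
    finally show ?case by simp
  next
    case (seq U)
    have "(\<integral>\<^sup>+ y. (SUP i. U i y) \<partial>K x) = (SUP i. \<integral>\<^sup>+ y. U i y \<partial>K x)" if "x \<in> space \<mu>" for x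
      using seq(3) mK[OF seq(1) that] by (intro nn_integral_monotone_convergence_SUP)
    then have "(\<integral>\<^sup>+ x. \<integral>\<^sup>+ y. (SUP i. U i y) \<partial>K x \<partial>\<mu>) = (\<integral>\<^sup>+ x. (SUP i. \<integral>\<^sup>+ y. U i y \<partial>K x) \<partial>\<mu>)"
      by (rule nn_integral_cong)
    also have "\<dots> = (SUP i. \<integral>\<^sup>+ x. \<integral>\<^sup>+ y. U i y \<partial>K x \<partial>\<mu>)"
    proof (rule nn_integral_monotone_convergence_SUP)
      show "incseq (\<lambda>i x. \<integral>\<^sup>+ y. U i y \<partial>K x)"
        using seq(3) by (fastforce simp: incseq_def le_fun_def intro!: nn_integral_mono)
    qed (rule mI[OF seq(1)])
    also have "\<dots> = (\<integral>\<^sup>+ y. (SUP i. U i y) \<partial>mixture \<mu> N K)"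
      using nn_integral_monotone_convergence_SUP[OF seq(3) mm[OF seq(1)]] seq.IH by simp
    finally show ?case by (simp add: image_image)
  qed
qed

text \<open>Local finiteness is expressed by countably many conditions, so that the set where a
  random measure violates it is measurable.\<close>

definition locally_finite_kernel :: "'a measure \<Rightarrow> ('a \<Rightarrow> real measure) \<Rightarrow> bool" where
  "locally_finite_kernel M K \<longleftrightarrow>
     (\<forall>a\<in>space M. sets (K a) = sets borel \<and> (\<forall>n::nat. emeasure (K a) {- real n..real n} < \<infinity>)) \<and>
     (\<forall>C\<in>sets borel. (\<lambda>a. emeasure (K a) C) \<in> borel_measurable M)"

lemma locally_finite_kernel_compose:
  assumes "locally_finite_kernel N K" "f \<in> M \<rightarrow>\<^sub>M N"
  shows "locally_finite_kernel M (\<lambda>a. K (f a))"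
  using assms measurable_space[OF assms(2)] measurable_compose[OF assms(2)]
  unfolding locally_finite_kernel_def by blast

lemma UN_symmetric_intervals: "(\<Union>n::nat. {- real n..real n}) = UNIV"
proof (intro equalityI subsetI UNIV_I)
  fix x :: real
  obtain n :: nat where "\<bar>x\<bar> \<le> real n" using real_arch_simple by blast
  then show "x \<in> (\<Union>n::nat. {- real n..real n})" by (auto simp: abs_le_iff intro!: exI[of _ n])
qed

text \<open>A Dynkin argument over rectangles. Its complement step subtracts measures and so needs
  them finite; hence everything is first cut down to \<open>{- real n..real n}\<close>, and the cut
  is removed at the end by continuity from below.\<close>

lemma measurable_emeasure_kernel_section:
  assumes K: "locally_finite_kernel M K" and C: "C \<in> sets (M \<Otimes>\<^sub>M borel)"
  shows "(\<lambda>a. emeasure (K a) (Pair a -` C)) \<in> borel_measurable M"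
proof -
  have sK: "sets (K a) = sets borel" if "a \<in> space M" for a
    using K that by (simp add: locally_finite_kernel_def)
  have sec: "Pair a -` D \<in> sets borel" if "D \<in> sets (M \<Otimes>\<^sub>M borel)" for a and D :: "('a \<times> real) set"
    using sets_Pair1[OF that] .
  have box: "(\<lambda>a. emeasure (K a) (Pair a -` C \<inter> {- real n..real n})) \<in> borel_measurable M"
    (is "?f C \<in> _") for n :: nat
  proof -
    have fin: "emeasure (K a) D \<noteq> \<infinity>" if "a \<in> space M" "D \<subseteq> {- real n..real n}" for a D
    proof -
      have "emeasure (K a) D \<le> emeasure (K a) {- real n..real n}"
        using that sK by (intro emeasure_mono) auto
      moreover have "emeasure (K a) {- real n..real n} < \<infinity>"
        using K that(1) by (simp add: locally_finite_kernel_def)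
      ultimately show ?thesis by (metis infinity_ennreal_def leD)
    qed
    have univ: "?f (space M \<times> UNIV) \<in> borel_measurable M"
    proof -
      have "?f (space M \<times> UNIV) a = emeasure (K a) {- real n..real n}" if "a \<in> space M" for a
        using that by (intro arg_cong[where f = "emeasure (K a)"]) auto
      moreover have "(\<lambda>a. emeasure (K a) {- real n..real n}) \<in> borel_measurable M"
        using K by (simp add: locally_finite_kernel_def)
      ultimately show ?thesis by (rule measurable_eqI[rotated])
    qed
    have C': "C \<in> sigma_sets (space M \<times> UNIV) {a \<times> b |a b. a \<in> sets M \<and> b \<in> sets borel}"
      using C sets_pair_measure[of M "borel :: real measure"] by simp
    show ?thesis
      using Int_stable_pair_measure_generator pair_measure_closed[of M borel, unfolded space_borel] C'
    proof (induct rule: sigma_sets_induct_disjoint)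
      case (basic D)
      then obtain A B where D: "D = A \<times> B" "A \<in> sets M" "B \<in> sets borel" by blast
      have "?f D a = indicator A a * emeasure (K a) (B \<inter> {- real n..real n})" for a
        using D by (auto simp: indicator_def vimage_def)
      moreover have "(\<lambda>a. emeasure (K a) (B \<inter> {- real n..real n})) \<in> borel_measurable M"
        using K D(3) unfolding locally_finite_kernel_def by (blast intro: atLeastAtMost_borel)
      ultimately show ?case using D by simp
    next
      case empty then show ?case by simp
    next
      case (compl D)
      have D: "D \<in> sets (M \<Otimes>\<^sub>M borel)" using compl by (simp add: sets_pair_measure)
      have "?f (space M \<times> UNIV - D) a = ?f (space M \<times> UNIV) a - ?f D a" if "a \<in> space M" for a
      proof -
        have "Pair a -` (space M \<times> UNIV - D) \<inter> {- real n..real n} =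
            (Pair a -` (space M \<times> UNIV) \<inter> {- real n..real n}) - (Pair a -` D \<inter> {- real n..real n})"
          by auto
        then show ?thesis using fin[OF that] that sec[OF D] sK[OF that]
          by (simp only:) (rule emeasure_Diff, auto)
      qed
      then show ?case 
        using measurable_eqI[OF borel_measurable_minus_ennreal[OF univ compl(2)]] by simp
    next
      case (union D)
      have D: "D i \<in> sets (M \<Otimes>\<^sub>M borel)" for i using union(2) by (auto simp: sets_pair_measure)
      have "?f (\<Union>i. D i) a = (\<Sum>i. ?f (D i) a)" if "a \<in> space M" for a
      proof -
        have "(\<Sum>i. ?f (D i) a) = emeasure (K a) (\<Union>i. Pair a -` D i \<inter> {- real n..real n})"
          using union(1) sec[OF D] sK[OF that]
          by (intro suminf_emeasure) (auto simp: disjoint_family_on_def)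
        then show ?thesis by (simp add: vimage_UN)
      qed
      then show ?case 
        using measurable_eqI[OF borel_measurable_suminf_order[OF union(3)]] by simp
    qed
  qed
  have "emeasure (K a) (Pair a -` C) = (SUP n. emeasure (K a) (Pair a -` C \<inter> {- real n..real n}))"
    if "a \<in> space M" for a
  proof -
    have "(\<Union>n. Pair a -` C \<inter> {- real n..real n}) = Pair a -` C"
      using UN_symmetric_intervals by blast
    moreover have "incseq (\<lambda>n. Pair a -` C \<inter> {- real n..real n})"
      by (auto simp: incseq_def)
    ultimately show ?thesis using sec[OF C] sK[OF that]
      by (subst SUP_emeasure_incseq) auto
  qed
  note eq = this
  have "(\<lambda>a. SUP n. emeasure (K a) (Pair a -` C \<inter> {- real n..real n})) \<in> borel_measurable M"
    by (intro borel_measurable_SUP box countableI_type)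
  then show ?thesis by (rule measurable_eqI) (rule eq)
qed

text \<open>The mixture of the images of \<open>K a\<close> under \<open>Pair a\<close> is the
  measure \<open>M(da) K a (ds)\<close> on the product. Viewing iterated integrals in this way
  reduces both claims to the two integration results for general kernels.\<close>

lemma
  assumes K: "locally_finite_kernel M K" and f: "f \<in> borel_measurable (M \<Otimes>\<^sub>M borel)"
  shows borel_measurable_nn_integral_section:
      "(\<lambda>a. \<integral>\<^sup>+ s. f (a, s) \<partial>K a) \<in> borel_measurable M" (is ?meas)
    and nn_integral_mixture_section:
      "(\<integral>\<^sup>+ p. f p \<partial>mixture M (M \<Otimes>\<^sub>M borel) (\<lambda>a. distr (K a) (M \<Otimes>\<^sub>M borel) (Pair a))) =
       (\<integral>\<^sup>+ a. (\<integral>\<^sup>+ s. f (a, s) \<partial>K a) \<partial>M)" (is ?mix)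
proof -
  let ?K = "\<lambda>a. distr (K a) (M \<Otimes>\<^sub>M borel) (Pair a)"
  have sK: "sets (K a) = sets borel" if "a \<in> space M" for a
    using K that by (simp add: locally_finite_kernel_def)
  have P: "Pair a \<in> K a \<rightarrow>\<^sub>M M \<Otimes>\<^sub>M borel" if "a \<in> space M" for a
    using measurable_Pair1'[OF that, of borel] measurable_cong_sets[OF sK[OF that] refl] by blast
  have meas: "(\<lambda>a. emeasure (?K a) C) \<in> borel_measurable M" if "C \<in> sets (M \<Otimes>\<^sub>M borel)" for C
  proof -
    have "emeasure (?K a) C = emeasure (K a) (Pair a -` C)" if "a \<in> space M" for a
      using \<open>C \<in> sets _\<close> emeasure_distr[OF P[OF that]] sets_eq_imp_space_eq[OF sK[OF that]] by simp
    then show ?thesis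
      using measurable_eqI[OF measurable_emeasure_kernel_section[OF K that]] by simp
  qed
  have I: "(\<integral>\<^sup>+ p. f p \<partial>?K a) = (\<integral>\<^sup>+ s. f (a, s) \<partial>K a)" if "a \<in> space M" for a
    using f by (intro nn_integral_distr[OF P[OF that]]) simp
  show ?meas
    using borel_measurable_nn_integral_kernel[where \<mu> = M and K = ?K and N = "M \<Otimes>\<^sub>M borel", OF _ meas f]
    by (rule measurable_eqI) (simp_all add: I)
  show ?mix
    using nn_integral_mixture[where \<mu> = M and K = ?K and N = "M \<Otimes>\<^sub>M borel", OF _ meas f] I
    by (simp cong: nn_integral_cong)
qed

section \<open>Measurability on path space\<close>

text \<open>The product sigma-algebra only knows fixed times. Continuity of the paths gives random
  times: round the time down to a grid, where it takes countably many values, and let the mesh tend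
  to 0.\<close>

lemma measurable_path_apply:
  assumes f: "f \<in> M \<rightarrow>\<^sub>M path_space" and g: "g \<in> borel_measurable M"
  shows "(\<lambda>a. f a (g a)) \<in> borel_measurable M"
proof (rule borel_measurable_LIMSEQ_real)
  let ?q = "\<lambda>n a. of_int \<lfloor>real (Suc n) * g a\<rfloor> / real (Suc n) :: real"
  show "(\<lambda>n. f a (?q n a)) \<longlonglongrightarrow> f a (g a)" if "a \<in> space M" for a
  proof -
    have "isCont (f a) (g a)"
      using measurable_space[OF f that] by (simp add: space_path_space continuous_on_eq_continuous_at)
    moreover have "(\<lambda>n. ?q n a) \<longlonglongrightarrow> g a"
    proof (rule tendsto_sandwich)
      show "\<forall>\<^sub>F n in sequentially. g a - 1 / real (Suc n) \<le> ?q n a"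
      proof (intro always_eventually allI)
        fix n
        have "real (Suc n) * g a - 1 \<le> of_int \<lfloor>real (Suc n) * g a\<rfloor>" by linarith
        then show "g a - 1 / real (Suc n) \<le> ?q n a"
          by (simp add: pos_le_divide_eq mult.commute[of _ "real (Suc n)"] right_diff_distrib del: of_nat_Suc)
      qed
      show "\<forall>\<^sub>F n in sequentially. ?q n a \<le> g a"
      proof (intro always_eventually allI)
        fix n
        have "of_int \<lfloor>real (Suc n) * g a\<rfloor> \<le> real (Suc n) * g a" by linarith
        then show "?q n a \<le> g a"
          by (simp add: pos_divide_le_eq mult.commute del: of_nat_Suc)
      qed
      show "(\<lambda>n. g a - 1 / real (Suc n)) \<longlonglongrightarrow> g a"
        using tendsto_diff[OF tendsto_const LIMSEQ_inverse_real_of_nat, of "g a"]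
        by (simp add: inverse_eq_divide)
    qed simp
    ultimately show ?thesis by (rule isCont_tendsto_compose)
  qed
  show "(\<lambda>a. f a (?q n a)) \<in> borel_measurable M" for n
  proof (rule measurable_compose_countable[where g = "\<lambda>a. \<lfloor>real (Suc n) * g a\<rfloor>"])
    show "(\<lambda>a. f a (real_of_int i / real (Suc n))) \<in> borel_measurable M" for i
      using measurable_compose[OF f measurable_path_eval] .
    show "(\<lambda>a. \<lfloor>real (Suc n) * g a\<rfloor>) \<in> M \<rightarrow>\<^sub>M count_space UNIV" using g by measurable
  qed
qed

lemma measurable_path_shift [measurable (raw)]:
  assumes f: "f \<in> M \<rightarrow>\<^sub>M path_space" and g: "g \<in> borel_measurable M"
  shows "(\<lambda>a. path_shift (g a) (f a)) \<in> M \<rightarrow>\<^sub>M path_space"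
proof (rule measurable_into_path_space)
  show "continuous_on UNIV (path_shift (g a) (f a))" if "a \<in> space M" for a
    unfolding path_shift_def
    using measurable_space[OF f that] unfolding space_path_space mem_Collect_eq
    by (rule continuous_on_compose2) (auto intro!: continuous_intros)
  show "(\<lambda>a. path_shift (g a) (f a) t) \<in> borel_measurable M" for t
    unfolding path_shift_def by (rule measurable_path_apply[OF f]) (use g in measurable)
qed

definition path_add :: "real \<Rightarrow> (real \<Rightarrow> real) \<Rightarrow> real \<Rightarrow> real" where
  "path_add x \<omega> = (\<lambda>t. \<omega> t + x)"

lemma measurable_path_add [measurable (raw)]:
  assumes f: "f \<in> M \<rightarrow>\<^sub>M path_space" and g: "g \<in> borel_measurable M"
  shows "(\<lambda>a. path_add (g a) (f a)) \<in> M \<rightarrow>\<^sub>M path_space"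
proof (rule measurable_into_path_space)
  show "continuous_on UNIV (path_add (g a) (f a))" if "a \<in> space M" for a
    using measurable_space[OF f that] unfolding path_add_def space_path_space mem_Collect_eq
    by (intro continuous_intros)
  show "(\<lambda>a. path_add (g a) (f a) t) \<in> borel_measurable M" for t
    unfolding path_add_def by (intro borel_measurable_add measurable_path_apply[OF f] g) simp
qed

lemma path_add_add [simp]: "path_add x (path_add y \<omega>) = path_add (x + y) \<omega>"
  by (simp add: path_add_def add_ac)

lemma path_add_0 [simp]: "path_add 0 \<omega> = \<omega>"
  by (simp add: path_add_def)

lemma path_shift_shift [simp]: "path_shift s (path_shift t \<omega>) = path_shift (s + t) \<omega>"
  by (simp add: path_shift_def add_ac)

lemma path_shift_0 [simp]: "path_shift 0 \<omega> = \<omega>"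
  by (simp add: path_shift_def)

lemma path_shift_add: "path_shift t (path_add x \<omega>) = path_add x (path_shift t \<omega>)"
  by (simp add: path_shift_def path_add_def)

lemma path_shift_in_space: "\<omega> \<in> space path_space \<Longrightarrow> path_shift t \<omega> \<in> space path_space"
  using measurable_space[OF measurable_path_shift[OF measurable_ident measurable_const]] by simp

lemma path_add_in_space: "\<omega> \<in> space path_space \<Longrightarrow> path_add x \<omega> \<in> space path_space"
  using measurable_space[OF measurable_path_add[OF measurable_ident measurable_const]] by simp

section \<open>The law of two-sided Brownian motion\<close>

text \<open>The right-hand side mentions neither \<open>M\<close> nor \<open>X\<close>, which is
  what uniqueness of the law rests on. The increments are independent normals, and since
  \<open>X\<close> vanishes at \<open>t m = 0\<close> almost surely, the value at \<open>t k\<close>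
  is the partial sum up to \<open>k\<close> minus the partial sum up to \<open>m\<close>; this
  treats negative and positive times alike.\<close>

lemma two_sided_BM_emeasure_increments:
  fixes t :: "nat \<Rightarrow> real"
  assumes BM: "two_sided_BM M X"
    and n: "n > 0" and t: "\<And>i. i < n \<Longrightarrow> t i < t (Suc i)"
    and m: "m \<le> n" "t m = 0"
    and A: "\<And>k. A k \<in> sets borel"
  shows "emeasure M {a \<in> space M. \<forall>k\<le>n. X a (t k) \<in> A k} =
    emeasure (\<Pi>\<^sub>M i\<in>{..<n}. density lborel (normal_density 0 (sqrt (t (Suc i) - t i))))
      {d \<in> space (\<Pi>\<^sub>M i\<in>{..<n}. borel). \<forall>k\<le>n. (\<Sum>i<k. d i) - (\<Sum>i<m. d i) \<in> A k}"
    (is "_ = emeasure ?N ?D")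
proof -
  interpret prob_space M using BM by (simp add: two_sided_BM_def)
  have [measurable]: "(\<lambda>a. X a s) \<in> borel_measurable M" for s
    using BM by (simp add: two_sided_BM_def)
  define \<Delta> where "\<Delta> = (\<lambda>a. \<lambda>i\<in>{..<n}. X a (t (Suc i)) - X a (t i))"
  have \<Delta>: "\<Delta> \<in> M \<rightarrow>\<^sub>M (\<Pi>\<^sub>M i\<in>{..<n}. borel)"
    unfolding \<Delta>_def by measurable
  have "(\<lambda>d. d i) \<in> borel_measurable (\<Pi>\<^sub>M i\<in>{..<n}. borel :: real measure)" if "i < n" for i
    using that by (intro measurable_component_singleton) auto
  then have sums: "(\<lambda>d. (\<Sum>i<k. d i) - (\<Sum>i<m. d i)) \<in> borel_measurable (\<Pi>\<^sub>M i\<in>{..<n}. borel :: real measure)"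
    if "k \<le> n" for k
    using that m by (intro borel_measurable_diff borel_measurable_sum) auto
  have D: "?D \<in> sets (\<Pi>\<^sub>M i\<in>{..<n}. borel)"
    unfolding atMost_iff[symmetric] Ball_def[symmetric]
  proof (rule sets.sets_Collect_finite_All)
    fix k assume "k \<in> {..n}"
    then have "(\<lambda>d. (\<Sum>i<k. d i) - (\<Sum>i<m. d i)) \<in> borel_measurable (\<Pi>\<^sub>M i\<in>{..<n}. borel :: real measure)"
      using sums by simp
    from measurable_sets[OF this A[of k]]
    show "{d \<in> space (\<Pi>\<^sub>M i\<in>{..<n}. borel :: real measure). (\<Sum>i<k. d i) - (\<Sum>i<m. d i) \<in> A k}
        \<in> sets (\<Pi>\<^sub>M i\<in>{..<n}. borel)"
      by (simp add: vimage_def Int_def conj_commute)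
  qed simp
  have indep: "indep_vars (\<lambda>_. borel) (\<lambda>i a. X a (t (Suc i)) - X a (t i)) {..<n}"
    using BM t by (simp add: two_sided_BM_def)
  have "distr M (\<Pi>\<^sub>M i\<in>{..<n}. borel) \<Delta> =
      (\<Pi>\<^sub>M i\<in>{..<n}. distr M borel (\<lambda>a. X a (t (Suc i)) - X a (t i)))"
    using indep n unfolding \<Delta>_def by (subst (asm) indep_vars_iff_distr_eq_PiM) auto
  also have "\<dots> = ?N"
  proof (rule PiM_cong[OF refl])
    fix i assume "i \<in> {..<n}"
    then have "distributed M lborel (\<lambda>a. X a (t (Suc i)) - X a (t i)) (normal_density 0 (sqrt (t (Suc i) - t i)))"
      using BM t by (simp add: two_sided_BM_def)
    then have "distr M lborel (\<lambda>a. X a (t (Suc i)) - X a (t i)) =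
        density lborel (normal_density 0 (sqrt (t (Suc i) - t i)))"
      by (rule distributed_distr_eq_density)
    then show "distr M borel (\<lambda>a. X a (t (Suc i)) - X a (t i)) =
        density lborel (normal_density 0 (sqrt (t (Suc i) - t i)))"
      by (simp cong: distr_cong)
  qed
  finally have law: "distr M (\<Pi>\<^sub>M i\<in>{..<n}. borel) \<Delta> = ?N" .
  have sum: "(\<Sum>i<k. \<Delta> a i) = X a (t k) - X a (t 0)" if "k \<le> n" for a k
  proof -
    have "(\<Sum>i<k. \<Delta> a i) = (\<Sum>i<k. X a (t (Suc i)) - X a (t i))"
      using that by (intro sum.cong) (auto simp: \<Delta>_def)
    then show ?thesis by (simp add: sum_lessThan_telescope[of "\<lambda>i. X a (t i)"])
  qed
  have "AE a in M. X a 0 = 0" using BM by (simp add: two_sided_BM_def)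
  then have "AE a in M. (\<forall>k\<le>n. X a (t k) \<in> A k) \<longleftrightarrow> \<Delta> a \<in> ?D"
    using AE_space
  proof eventually_elim
    case (elim a)
    then show ?case using m measurable_space[OF \<Delta>] by (simp add: sum)
  qed
  then have "emeasure M {a \<in> space M. \<forall>k\<le>n. X a (t k) \<in> A k} = emeasure M (\<Delta> -` ?D \<inter> space M)"
    using A measurable_sets[OF \<Delta> D] by (intro emeasure_eq_AE) (auto intro!: sets.sets_Collect_countable_Ball)
  also have "\<dots> = emeasure ?N ?D"
    using emeasure_distr[OF \<Delta> D] law by simp
  finally show ?thesis .
qed

lemma two_sided_BM_emeasure_cylinder_eq:
  assumes X: "two_sided_BM M X" and Y: "two_sided_BM M' Y"
    and J: "finite J" and A: "\<And>j. A j \<in> sets borel"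
  shows "emeasure M {a \<in> space M. \<forall>j\<in>J. X a j \<in> A j} = emeasure M' {a \<in> space M'. \<forall>j\<in>J. Y a j \<in> A j}"
proof -
  \<comment> \<open>Time 0 anchors the increments, and time 1 guarantees that there is at least one
    increment. At the added times the constraint will be \<open>UNIV\<close>.\<close>
  define J' where "J' = insert 0 (insert 1 J)"
  define ts where "ts = sorted_list_of_set J'"
  have "finite J'" using J by (simp add: J'_def)
  then have J': "finite J'" "set ts = J'" "length ts = card J'"
    by (simp_all add: ts_def)
  have "card {0, 1 :: real} \<le> card J'"
    using J' by (intro card_mono) (auto simp: J'_def)
  then have c: "card J' \<ge> 2" by simp
  define n where "n = card J' - 1"
  define t where "t = (\<lambda>i. ts ! i)"
  have n: "n > 0" "length ts = Suc n" using c J' by (auto simp: n_def)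
  have t: "t i < t (Suc i)" if "i < n" for i
    using sorted_wrt_nth_less[OF strict_sorted_list_of_set, of i "Suc i" J'] that n
    by (simp add: t_def ts_def)
  have "t ` {..n} = set ts"
    by (force simp: t_def set_conv_nth n(2) less_Suc_eq_le)
  then have tJ': "t ` {..n} = J'" by (simp add: J'(2))
  moreover have "0 \<in> J'" by (simp add: J'_def)
  ultimately obtain m where m: "m \<le> n" "t m = 0" by auto
  define A' where "A' = (\<lambda>k. if t k \<in> J then A (t k) else UNIV)"
  have A': "A' k \<in> sets borel" for k using A by (simp add: A'_def)
  have eq: "(\<forall>j\<in>J. x j \<in> A j) \<longleftrightarrow> (\<forall>k\<le>n. x (t k) \<in> A' k)" for x :: "real \<Rightarrow> real"
  proof -
    have "J \<subseteq> t ` {..n}" unfolding tJ' J'_def by auto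
    then show ?thesis unfolding A'_def by (auto simp: subset_iff image_iff)
  qed
  show ?thesis unfolding eq
    using two_sided_BM_emeasure_increments[OF X n(1) t m A']
      two_sided_BM_emeasure_increments[OF Y n(1) t m A'] by simp
qed

lemma two_sided_BM_measurable: "two_sided_BM M X \<Longrightarrow> X \<in> M \<rightarrow>\<^sub>M path_space"
  by (rule measurable_into_path_space) (auto simp: two_sided_BM_def)

text \<open>Cylinder probabilities determine a finite measure on the full product space. The
  sigma-algebra of \<open>path_space\<close> is the trace of the product one, and a path-valued map
  has the same preimage of a set and of its trace, so the equality descends.\<close>

theorem two_sided_BM_law_unique:
  assumes X: "two_sided_BM M X" and Y: "two_sided_BM M' Y"
  shows "distr M path_space X = distr M' path_space Y"
proof -
  let ?\<Pi> = "\<Pi>\<^sub>M t\<in>(UNIV :: real set). borel :: real measure"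
  note mX = two_sided_BM_measurable[OF X] and mY = two_sided_BM_measurable[OF Y]
  have inc: "Z \<in> N \<rightarrow>\<^sub>M ?\<Pi>" if "Z \<in> N \<rightarrow>\<^sub>M path_space" for N :: "'c measure" and Z
    using measurable_space[OF that] measurable_compose[OF that measurable_path_eval]
      measurable_restrict[of UNIV "\<lambda>t a. Z a t" N "\<lambda>_. borel"] by (simp add: restrict_UNIV)
  have em: "emeasure (distr N ?\<Pi> Z) (prod_emb UNIV (\<lambda>_. borel) J (Pi\<^sub>E J A)) =
      emeasure N {a \<in> space N. \<forall>j\<in>J. Z a j \<in> A j}"
    if "Z \<in> N \<rightarrow>\<^sub>M ?\<Pi>" "finite J" "\<And>j. j \<in> J \<Longrightarrow> A j \<in> sets borel" for N :: "'c measure" and Z J A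
  proof -
    have "prod_emb UNIV (\<lambda>_. borel) J (Pi\<^sub>E J A) \<in> sets ?\<Pi>"
      using that by (intro sets_PiM_I) auto
    moreover have "Z -` prod_emb UNIV (\<lambda>_. borel) J (Pi\<^sub>E J A) \<inter> space N = {a \<in> space N. \<forall>j\<in>J. Z a j \<in> A j}"
      by (auto simp: prod_emb_def)
    ultimately show ?thesis using that by (simp add: emeasure_distr)
  qed
  have \<Pi>: "distr M ?\<Pi> X = distr M' ?\<Pi> Y"
  proof (rule measure_eqI_PiM_infinite)
    interpret prob_space M using X by (simp add: two_sided_BM_def)
    show "finite_measure (distr M ?\<Pi> X)" by (rule finite_measure_distr[OF inc[OF mX]])
    fix A :: "real \<Rightarrow> real set" and J :: "real set"
    assume J: "finite J" and A: "\<And>j. j \<in> J \<Longrightarrow> A j \<in> sets borel"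
    define A' where "A' j = (if j \<in> J then A j else UNIV)" for j
    have "A' j \<in> sets borel" for j using A by (simp add: A'_def)
    from two_sided_BM_emeasure_cylinder_eq[where A = A', OF X Y J this]
    have "emeasure M {a \<in> space M. \<forall>j\<in>J. X a j \<in> A j} = emeasure M' {a \<in> space M'. \<forall>j\<in>J. Y a j \<in> A j}"
      by (simp add: A'_def cong: ball_cong)
    then
    show "emeasure (distr M ?\<Pi> X) (prod_emb UNIV (\<lambda>_. borel) J (Pi\<^sub>E J A)) =
        emeasure (distr M' ?\<Pi> Y) (prod_emb UNIV (\<lambda>_. borel) J (Pi\<^sub>E J A))"
      by (simp only: em[OF inc[OF mX] J A] em[OF inc[OF mY] J A])
  qed simp_all
  show ?thesis
  proof (rule measure_eqI)
    fix B assume "B \<in> sets (distr M path_space X)"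
    then have B: "B \<in> sets path_space" by simp
    then obtain B' where B': "B' \<in> sets ?\<Pi>" "B = space path_space \<inter> B'"
      unfolding space_path_space by (auto simp: path_space_def sets_restrict_space)
    have *: "emeasure (distr N path_space Z) B = emeasure (distr N ?\<Pi> Z) B'"
      if "Z \<in> N \<rightarrow>\<^sub>M path_space" for N :: "'c measure" and Z
    proof -
      have "Z -` B \<inter> space N = Z -` B' \<inter> space N"
        using B'(2) measurable_space[OF that] by auto
      then show ?thesis
        by (simp add: emeasure_distr[OF that B] emeasure_distr[OF inc[OF that] B'(1)])
    qed
    show "emeasure (distr M path_space X) B = emeasure (distr M' path_space Y) B"
      using *[OF mX] *[OF mY] \<Pi> by simp
  qed simp
qed

text \<open>The probabilistic clauses of the definition depend only on the law of finitely many
  coordinates and transfer along \<open>X\<close>; continuity of every path comes from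
  \<open>X\<close> taking its values in \<open>path_space\<close>.\<close>

lemma two_sided_BM_of_law:
  assumes P0: "brownian_law P0" and M: "prob_space M"
    and X: "X \<in> M \<rightarrow>\<^sub>M path_space" and law: "distr M path_space X = P0"
  shows "two_sided_BM M X"
proof -
  interpret M: prob_space M by fact
  have BM: "two_sided_BM P0 (\<lambda>\<omega>. \<omega>)" using P0 by (simp add: brownian_law_def)
  interpret P0: prob_space P0 using BM by (simp add: two_sided_BM_def)
  have ev [measurable]: "(\<lambda>\<omega>. \<omega> t) \<in> borel_measurable path_space" for t
    by (rule measurable_path_eval)
  have evP [measurable]: "(\<lambda>\<omega>. \<omega> t) \<in> borel_measurable P0" for t
    using BM by (simp add: two_sided_BM_def)
  have eX [measurable]: "(\<lambda>a. X a t) \<in> borel_measurable M" for t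
    using measurable_compose[OF X ev] .
  have push: "distr P0 N f = distr M N (\<lambda>a. f (X a))" if "f \<in> path_space \<rightarrow>\<^sub>M N"
    for N :: "'c measure" and f
    using distr_distr[OF that X] law by (simp add: comp_def)
  show ?thesis unfolding two_sided_BM_def
  proof (intro conjI allI impI ballI)
    show "prob_space M" by fact
    show "(\<lambda>a. X a t) \<in> borel_measurable M" for t by simp
    show "continuous_on UNIV (X a)" if "a \<in> space M" for a
      using measurable_space[OF X that] by (simp add: space_path_space)
    show "AE a in M. X a 0 = 0"
    proof (rule AE_distrD[OF X])
      show "AE \<omega> in distr M path_space X. \<omega> 0 = 0"
        unfolding law using BM by (simp add: two_sided_BM_def)
    qed
    fix s t :: real assume "s < t"
    then have "distributed P0 lborel (\<lambda>\<omega>. \<omega> t - \<omega> s) (normal_density 0 (sqrt (t - s)))"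
      using BM by (simp add: two_sided_BM_def)
    moreover have "distr P0 lborel (\<lambda>\<omega>. \<omega> t - \<omega> s) = distr M lborel (\<lambda>a. X a t - X a s)"
      by (rule push) measurable
    ultimately show "distributed M lborel (\<lambda>a. X a t - X a s) (normal_density 0 (sqrt (t - s)))"
      unfolding distributed_def by auto
  next
    fix n :: nat and t :: "nat \<Rightarrow> real"
    assume t: "\<forall>i<n. t i < t (Suc i)"
    let ?d = "\<lambda>i \<omega>. \<omega> (t (Suc i)) - \<omega> (t i) :: real"
    have indep: "P0.indep_vars (\<lambda>_. borel) ?d {..<n}"
      using BM t by (simp add: two_sided_BM_def)
    show "M.indep_vars (\<lambda>_. borel) (\<lambda>i a. ?d i (X a)) {..<n}"
    \<comment> \<open>Independence is characterised below by a product of laws, which requires a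
      nonempty index set.\<close>
    proof (cases "n = 0")
      case True
      then show ?thesis by (simp add: M.indep_vars_def M.indep_sets_def)
    next
      case False
      have "distr M (\<Pi>\<^sub>M i\<in>{..<n}. borel) (\<lambda>a. \<lambda>i\<in>{..<n}. ?d i (X a)) =
          distr P0 (\<Pi>\<^sub>M i\<in>{..<n}. borel) (\<lambda>\<omega>. \<lambda>i\<in>{..<n}. ?d i \<omega>)"
        by (rule push[symmetric]) measurable
      also have "\<dots> = (\<Pi>\<^sub>M i\<in>{..<n}. distr P0 borel (?d i))"
        using indep False by (subst (asm) P0.indep_vars_iff_distr_eq_PiM) auto
      also have "\<dots> = (\<Pi>\<^sub>M i\<in>{..<n}. distr M borel (\<lambda>a. ?d i (X a)))"
        by (intro PiM_cong refl push) measurable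
      finally show ?thesis
        using False by (subst M.indep_vars_iff_distr_eq_PiM) auto
    qed
  qed
qed

text \<open>At a deterministic time the subtracted value \<open>X a s\<close> cancels in every
  increment, so the increments are those of \<open>X\<close> at the times moved by
  \<open>s\<close>.\<close>

lemma two_sided_BM_shift:
  assumes BM: "two_sided_BM M X"
  shows "two_sided_BM M (\<lambda>a t. X a (s + t) - X a s)"
  unfolding two_sided_BM_def
proof (intro conjI allI impI ballI)
  have [measurable]: "(\<lambda>a. X a t) \<in> borel_measurable M" for t
    using BM by (simp add: two_sided_BM_def)
  show "prob_space M" using BM by (simp add: two_sided_BM_def)
  show "(\<lambda>a. X a (s + t) - X a s) \<in> borel_measurable M" for t by measurable
  show "continuous_on UNIV (\<lambda>t. X a (s + t) - X a s)" if "a \<in> space M" for a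
  proof -
    have "continuous_on UNIV (X a)" using BM that by (simp add: two_sided_BM_def)
    then have "continuous_on UNIV (\<lambda>t. X a (s + t))"
      by (rule continuous_on_compose2) (auto intro!: continuous_intros)
    then show ?thesis by (intro continuous_intros)
  qed
  show "AE a in M. X a (s + 0) - X a s = 0" by simp
next
  fix u v :: real assume "u < v"
  have incr: "distributed M lborel (\<lambda>a. X a v - X a u) (normal_density 0 (sqrt (v - u)))"
    if "u < v" for u v
    using BM that by (simp add: two_sided_BM_def)
  have "distributed M lborel (\<lambda>a. X a (s + v) - X a (s + u))
      (normal_density 0 (sqrt ((s + v) - (s + u))))"
    by (rule incr) (use \<open>u < v\<close> in simp)
  then show "distributed M lborel (\<lambda>a. X a (s + v) - X a s - (X a (s + u) - X a s)) (normal_density 0 (sqrt (v - u)))"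
    by simp
next
  fix n :: nat and t :: "nat \<Rightarrow> real" assume t: "\<forall>i<n. t i < t (Suc i)"
  have incr: "prob_space.indep_vars M (\<lambda>_. borel) (\<lambda>i a. X a (u (Suc i)) - X a (u i)) {..<n}"
    if "\<forall>i<n. u i < u (Suc i)" for u :: "nat \<Rightarrow> real"
    using BM that by (simp add: two_sided_BM_def)
  have "prob_space.indep_vars M (\<lambda>_. borel) (\<lambda>i a. X a (s + t (Suc i)) - X a (s + t i)) {..<n}"
    by (rule incr[of "\<lambda>i. s + t i"]) (use t in simp)
  then show "prob_space.indep_vars M (\<lambda>_. borel)
      (\<lambda>i a. X a (s + t (Suc i)) - X a s - (X a (s + t i) - X a s)) {..<n}" by simp
qed

section \<open>The stationary law\<close>

lemma nn_integral_lborel_uminus: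
  fixes f :: "real \<Rightarrow> ennreal"
  assumes "f \<in> borel_measurable borel"
  shows "(\<integral>\<^sup>+ x. f (- x) \<partial>lborel) = (\<integral>\<^sup>+ x. f x \<partial>lborel)"
  using nn_integral_real_affine[of f "- 1" 0] assms by simp

lemma nn_integral_lborel_translate:
  fixes f :: "real \<Rightarrow> ennreal"
  assumes "f \<in> borel_measurable borel"
  shows "(\<integral>\<^sup>+ x. f (t + x) \<partial>lborel) = (\<integral>\<^sup>+ x. f x \<partial>lborel)"
  using nn_integral_real_affine[of f 1 t] assms by simp

locale canonical_BM =
  fixes P0 :: "(real \<Rightarrow> real) measure"
  assumes brownian: "brownian_law P0"
begin

lemma sets_P0 [measurable_cong, simp]: "sets P0 = sets path_space"
  using brownian by (simp add: brownian_law_def)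

lemma space_P0 [simp]: "space P0 = space path_space"
  by (rule sets_eq_imp_space_eq) simp

lemma two_sided_BM_P0: "two_sided_BM P0 (\<lambda>\<omega>. \<omega>)"
  using brownian by (simp add: brownian_law_def)

sublocale prob_space P0
  using two_sided_BM_P0 by (simp add: two_sided_BM_def)

abbreviation "P \<equiv> stationary_law P0"

lemma sets_P [measurable_cong, simp]: "sets P = sets path_space"
  by (simp add: stationary_law_def)

lemma space_P [simp]: "space P = space path_space"
  by (simp add: stationary_law_def)

lemma law_from_eq: "law_from P0 x = distr P0 path_space (path_add x)"
  by (simp add: law_from_def path_add_def[abs_def])

lemma nn_integral_stationary:
  assumes [measurable]: "f \<in> borel_measurable path_space"
  shows "(\<integral>\<^sup>+ \<omega>. f \<omega> \<partial>P) = (\<integral>\<^sup>+ x. (\<integral>\<^sup>+ \<omega>. f (path_add x \<omega>) \<partial>P0) \<partial>lborel)"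
proof -
  have m [measurable]: "path_add x \<in> P0 \<rightarrow>\<^sub>M path_space" for x
    by (rule measurable_path_add) measurable
  have "(\<integral>\<^sup>+ \<omega>. f \<omega> \<partial>P) = (\<integral>\<^sup>+ x. (\<integral>\<^sup>+ \<omega>. f \<omega> \<partial>law_from P0 x) \<partial>lborel)"
    unfolding stationary_law_def
  proof (rule nn_integral_mixture)
    fix A assume A [measurable]: "A \<in> sets path_space"
    have "emeasure (law_from P0 x) A = (\<integral>\<^sup>+ \<omega>. indicator A (path_add x \<omega>) \<partial>P0)" for x
      using A nn_integral_distr[OF m[of x], of "indicator A"] by (simp add: law_from_eq)
    then show "(\<lambda>x. emeasure (law_from P0 x) A) \<in> borel_measurable lborel"
      by (simp only:) measurable
  qed (simp_all add: law_from_eq assms)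
  then show ?thesis by (simp add: law_from_eq nn_integral_distr)
qed

lemma nn_integral_stationary_path_add:
  assumes [measurable]: "f \<in> borel_measurable path_space"
  shows "(\<integral>\<^sup>+ \<omega>. f (path_add y \<omega>) \<partial>P) = (\<integral>\<^sup>+ \<omega>. f \<omega> \<partial>P)"
proof -
  have "(\<integral>\<^sup>+ \<omega>. f (path_add y \<omega>) \<partial>P) = (\<integral>\<^sup>+ x. (\<integral>\<^sup>+ \<omega>. f (path_add (y + x) \<omega>) \<partial>P0) \<partial>lborel)"
    by (subst nn_integral_stationary) simp_all
  also have "\<dots> = (\<integral>\<^sup>+ \<omega>. f \<omega> \<partial>P)"
    by (subst nn_integral_lborel_translate[where f = "\<lambda>x. \<integral>\<^sup>+ \<omega>. f (path_add x \<omega>) \<partial>P0"])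
      (simp_all add: nn_integral_stationary)
  finally show ?thesis .
qed

text \<open>The sign is chosen to match \<open>lt x \<omega>\<close>, which is \<open>lt0\<close> at
  \<open>path_add (- x) \<omega>\<close>: the integration variable can then be read as a
  level.\<close>

lemma nn_integral_stationary_minus:
  assumes [measurable]: "f \<in> borel_measurable path_space"
  shows "(\<integral>\<^sup>+ \<omega>. f \<omega> \<partial>P) = (\<integral>\<^sup>+ \<omega>. (\<integral>\<^sup>+ x. f (path_add (- x) \<omega>) \<partial>lborel) \<partial>P0)"
proof -
  interpret pair_sigma_finite lborel P0 ..
  have "(\<integral>\<^sup>+ \<omega>. f \<omega> \<partial>P) = (\<integral>\<^sup>+ x. (\<integral>\<^sup>+ \<omega>. f (path_add (- x) \<omega>) \<partial>P0) \<partial>lborel)"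
    by (subst nn_integral_lborel_uminus[where f = "\<lambda>x. \<integral>\<^sup>+ \<omega>. f (path_add x \<omega>) \<partial>P0"])
      (simp_all add: nn_integral_stationary)
  also have "\<dots> = (\<integral>\<^sup>+ \<omega>. (\<integral>\<^sup>+ x. f (path_add (- x) \<omega>) \<partial>lborel) \<partial>P0)"
    by (rule Fubini'[symmetric]) measurable
  finally show ?thesis .
qed

text \<open>Instead of working with \<open>P\<close> as a factor of a product, \<open>P\<close> is
  unfolded and \<open>\<nu>\<close> is exchanged first with \<open>P0\<close>, then with Lebesgue
  measure.\<close>

lemma stationary_Fubini:
  assumes "prob_space \<nu>" and [measurable]: "case_prod h \<in> borel_measurable (path_space \<Otimes>\<^sub>M \<nu>)"
  shows "(\<integral>\<^sup>+ \<omega>. (\<integral>\<^sup>+ y. h \<omega> y \<partial>\<nu>) \<partial>P) = (\<integral>\<^sup>+ y. (\<integral>\<^sup>+ \<omega>. h \<omega> y \<partial>P) \<partial>\<nu>)"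
proof -
  interpret \<nu>: prob_space \<nu> by fact
  interpret A: pair_sigma_finite \<nu> P0 ..
  interpret B: pair_sigma_finite \<nu> lborel ..
  have "(\<integral>\<^sup>+ \<omega>. (\<integral>\<^sup>+ y. h \<omega> y \<partial>\<nu>) \<partial>P) =
      (\<integral>\<^sup>+ x. (\<integral>\<^sup>+ \<omega>. (\<integral>\<^sup>+ y. h (path_add x \<omega>) y \<partial>\<nu>) \<partial>P0) \<partial>lborel)"
    by (rule nn_integral_stationary) measurable
  also have "\<dots> = (\<integral>\<^sup>+ x. (\<integral>\<^sup>+ y. (\<integral>\<^sup>+ \<omega>. h (path_add x \<omega>) y \<partial>P0) \<partial>\<nu>) \<partial>lborel)"
    by (intro nn_integral_cong A.Fubini') measurable
  also have "\<dots> = (\<integral>\<^sup>+ y. (\<integral>\<^sup>+ x. (\<integral>\<^sup>+ \<omega>. h (path_add x \<omega>) y \<partial>P0) \<partial>lborel) \<partial>\<nu>)"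
    by (rule B.Fubini') measurable
  also have "\<dots> = (\<integral>\<^sup>+ y. (\<integral>\<^sup>+ \<omega>. h \<omega> y \<partial>P) \<partial>\<nu>)"
    by (intro nn_integral_cong nn_integral_stationary[symmetric]) measurable
  finally show ?thesis .
qed

lemma nn_integral_P0_recentred_shift:
  assumes f: "f \<in> borel_measurable path_space"
  shows "(\<integral>\<^sup>+ \<omega>. f (path_add (- \<omega> s) (path_shift s \<omega>)) \<partial>P0) = (\<integral>\<^sup>+ \<omega>. f \<omega> \<partial>P0)"
proof -
  let ?X = "\<lambda>\<omega>. path_add (- \<omega> s) (path_shift s \<omega>)"
  have "(\<lambda>\<omega>. \<omega> s) \<in> borel_measurable P0"
    by (subst measurable_cong_sets[OF sets_P0 refl]) (rule measurable_path_eval)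
  then have "(\<lambda>\<omega>. - \<omega> s) \<in> borel_measurable P0"
    by (rule borel_measurable_uminus)
  then have X: "?X \<in> P0 \<rightarrow>\<^sub>M path_space"
    by (rule measurable_path_add[rotated]) measurable
  have "?X = (\<lambda>\<omega> t. \<omega> (s + t) - \<omega> s)"
    by (simp add: path_add_def path_shift_def)
  with two_sided_BM_shift[OF two_sided_BM_P0, of s] have "two_sided_BM P0 ?X" by simp
  then have "distr P0 path_space ?X = distr P0 path_space (\<lambda>\<omega>. \<omega>)"
    using two_sided_BM_P0 by (rule two_sided_BM_law_unique)
  also have "\<dots> = P0" by (rule distr_id2) simp
  finally have "distr P0 path_space ?X = P0" .
  with nn_integral_distr[OF X, of f] f show ?thesis by simp
qed

end

section \<open>Local times and their Palm measures\<close>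

locale BM_local_time = canonical_BM +
  fixes l :: "real \<Rightarrow> (real \<Rightarrow> real) \<Rightarrow> real measure"
  assumes local_time: "local_time P0 l"
begin

text \<open>
  The given version is only almost everywhere locally finite. Replacing it by the null measure on
  the exceptional set gives a kernel that can be integrated without further provisos.
\<close>

definition lt0 :: "(real \<Rightarrow> real) \<Rightarrow> real measure" where
  "lt0 \<omega> = (if \<forall>n::nat. emeasure (l 0 \<omega>) {- real n..real n} < \<infinity> then l 0 \<omega> else null_measure borel)"

text \<open>Covariance in the level is built in, so all levels share one kernel and joint
  measurability in path and level comes from \<open>lt0\<close> alone.\<close>

definition lt :: "real \<Rightarrow> (real \<Rightarrow> real) \<Rightarrow> real measure" where
  "lt x \<omega> = lt0 (path_add (- x) \<omega>)"

definition infinite_set :: "(real \<Rightarrow> real) set" where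
  "infinite_set = {\<omega> \<in> space path_space. \<not> (\<forall>n::nat. emeasure (l 0 \<omega>) {- real n..real n} < \<infinity>)}"

lemma random_measure_l0: "random_measure P (l 0)"
  using local_time by (simp add: local_time_def)

lemma l_eq: "\<omega> \<in> space path_space \<Longrightarrow> l x \<omega> = l 0 (path_add (- x) \<omega>)"
  using local_time by (simp add: local_time_def path_add_def)

lemma measurable_l0 [measurable]:
  "C \<in> sets borel \<Longrightarrow> (\<lambda>\<omega>. emeasure (l 0 \<omega>) C) \<in> borel_measurable path_space"
  using random_measure_l0 by (simp add: random_measure_def)

lemma infinite_set_sets [measurable]: "infinite_set \<in> sets path_space"
  unfolding infinite_set_def by measurable

lemma lt0_eq: "\<omega> \<in> space path_space \<Longrightarrow> \<omega> \<notin> infinite_set \<Longrightarrow> lt0 \<omega> = l 0 \<omega>"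
  by (auto simp: lt0_def infinite_set_def)

lemma lt_eq:
  assumes "\<omega> \<in> space path_space" "path_add (- x) \<omega> \<notin> infinite_set"
  shows "lt x \<omega> = l x \<omega>"
  using assms(2) lt0_eq[of "path_add (- x) \<omega>"] path_add_in_space[OF assms(1)]
  unfolding lt_def l_eq[OF assms(1), of x] by blast

lemma AE_not_infinite_set: "AE \<omega> in P. \<omega> \<notin> infinite_set"
proof -
  have "AE \<omega> in P. \<forall>K. compact K \<longrightarrow> emeasure (l 0 \<omega>) K < \<infinity>"
    using random_measure_l0 by (simp add: random_measure_def)
  then show ?thesis by eventually_elim (auto simp: infinite_set_def)
qed

lemma kernel_lt0: "locally_finite_kernel path_space lt0"
  unfolding locally_finite_kernel_def
proof (intro conjI ballI allI)
  fix C :: "real set" assume [measurable]: "C \<in> sets borel"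
  have "emeasure (lt0 \<omega>) C = (if \<omega> \<in> infinite_set then 0 else emeasure (l 0 \<omega>) C)"
    if "\<omega> \<in> space path_space" for \<omega>
    using that by (auto simp: lt0_def infinite_set_def)
  moreover have "(\<lambda>\<omega>. if \<omega> \<in> infinite_set then 0 else emeasure (l 0 \<omega>) C) \<in> borel_measurable path_space"
    by measurable
  ultimately show "(\<lambda>\<omega>. emeasure (lt0 \<omega>) C) \<in> borel_measurable path_space"
    by (rule measurable_eqI[rotated])
next
  fix \<omega> assume "\<omega> \<in> space path_space"
  then show "sets (lt0 \<omega>) = sets borel"
    using random_measure_l0 by (simp add: lt0_def random_measure_def)
  show "emeasure (lt0 \<omega>) {- real n..real n} < \<infinity>" for n
  proof (cases "\<forall>n::nat. emeasure (l 0 \<omega>) {- real n..real n} < \<infinity>")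
    case True
    then show ?thesis unfolding lt0_def if_P[OF True] by (rule spec)
  next
    case False
    then show ?thesis unfolding lt0_def if_not_P[OF False] by simp
  qed
qed

lemma kernel_lt:
  assumes "f \<in> M \<rightarrow>\<^sub>M path_space" "g \<in> borel_measurable M"
  shows "locally_finite_kernel M (\<lambda>a. lt (g a) (f a))"
  unfolding lt_def
  by (rule locally_finite_kernel_compose[OF kernel_lt0]) (use assms in measurable)

lemma sets_lt: "\<omega> \<in> space path_space \<Longrightarrow> sets (lt x \<omega>) = sets borel"
  using kernel_lt0 path_add_in_space[of \<omega> "- x"] by (simp add: lt_def locally_finite_kernel_def)

lemma measurable_lt:
  "\<omega> \<in> space path_space \<Longrightarrow> h \<in> borel_measurable borel \<Longrightarrow> h \<in> borel_measurable (lt x \<omega>)"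
  by (subst measurable_cong_sets[OF sets_lt refl])

lemma borel_measurable_emeasure_lt [measurable (raw)]:
  assumes "f \<in> M \<rightarrow>\<^sub>M path_space" "g \<in> borel_measurable M" "C \<in> sets borel"
  shows "(\<lambda>a. emeasure (lt (g a) (f a)) C) \<in> borel_measurable M"
  using kernel_lt[OF assms(1,2)] assms(3) by (simp add: locally_finite_kernel_def)

lemma borel_measurable_nn_integral_lt [measurable (raw)]:
  assumes "f \<in> M \<rightarrow>\<^sub>M path_space" "g \<in> borel_measurable M"
    and "case_prod h \<in> borel_measurable (M \<Otimes>\<^sub>M borel)"
  shows "(\<lambda>a. \<integral>\<^sup>+ s. h a s \<partial>lt (g a) (f a)) \<in> borel_measurable M"
  using borel_measurable_nn_integral_section[OF kernel_lt[OF assms(1,2)] assms(3)] by simp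

text \<open>To pass from \<open>l\<close> to \<open>lt\<close> under the level integral, the level
  \<open>x\<close> is bad for \<open>\<omega>\<close> when \<open>path_add (- x) \<omega>\<close>
  lies in \<open>infinite_set\<close>. This set is \<open>P\<close>-null, and disintegrating
  \<open>P\<close> over starting points says that for \<open>P0\<close>-almost every path
  Lebesgue-almost every level is good.\<close>

lemma occupation_rectangle:
  assumes [measurable]: "C \<in> sets borel" "D \<in> sets borel"
  shows "AE \<omega> in P0. (\<integral>\<^sup>+ s. indicator C (\<omega> s) * indicator D s \<partial>lborel) =
    (\<integral>\<^sup>+ x. indicator C x * emeasure (lt x \<omega>) D \<partial>lborel)"
proof -
  let ?f = "indicator (C \<times> D) :: real \<times> real \<Rightarrow> real"
  have "?f \<in> borel_measurable borel"
    by (intro borel_measurable_indicator) (simp add: borel_prod[symmetric])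
  then have 1: "AE \<omega> in P0. (\<integral>\<^sup>+ s. ?f (\<omega> s, s) \<partial>lborel) =
      (\<integral>\<^sup>+ x. (\<integral>\<^sup>+ s. ?f (x, s) \<partial>l x \<omega>) \<partial>lborel)"
    using local_time by (simp add: local_time_def)
  have "(\<integral>\<^sup>+ \<omega>. indicator infinite_set \<omega> \<partial>P) = 0"
    using AE_not_infinite_set by (subst nn_integral_0_iff_AE) (auto simp: indicator_def)
  then have "(\<integral>\<^sup>+ \<omega>. (\<integral>\<^sup>+ x. indicator infinite_set (path_add (- x) \<omega>) \<partial>lborel) \<partial>P0) = 0"
    by (subst (asm) nn_integral_stationary_minus) measurable
  then have 2: "AE \<omega> in P0. (\<integral>\<^sup>+ x. indicator infinite_set (path_add (- x) \<omega>) \<partial>lborel) = 0"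
    by (subst (asm) nn_integral_0_iff_AE) auto
  show ?thesis using 1 2 AE_space
  proof eventually_elim
    case (elim \<omega>)
    then have \<omega> [measurable]: "\<omega> \<in> space path_space" by simp
    have "(\<lambda>x. indicator infinite_set (path_add (- x) \<omega>) :: ennreal) \<in> borel_measurable lborel" by measurable
    with elim(2) have "AE x in lborel. path_add (- x) \<omega> \<notin> infinite_set"
      by (subst (asm) nn_integral_0_iff_AE) (auto simp: indicator_def elim!: eventually_mono)
    then have "AE x in lborel. (\<integral>\<^sup>+ s. ?f (x, s) \<partial>l x \<omega>) = indicator C x * emeasure (lt x \<omega>) D"
    proof eventually_elim
      case (elim x)
      have "(\<integral>\<^sup>+ s. ?f (x, s) \<partial>lt x \<omega>) = (\<integral>\<^sup>+ s. indicator C x * indicator D s \<partial>lt x \<omega>)"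
        by (intro nn_integral_cong) (auto simp: indicator_def)
      also have "\<dots> = indicator C x * emeasure (lt x \<omega>) D"
        using sets_lt[OF \<omega>, of x] by (subst nn_integral_cmult) (auto intro!: measurable_lt[OF \<omega>])
      finally show ?case by (simp add: lt_eq[OF \<omega> elim])
    qed
    then have "(\<integral>\<^sup>+ x. (\<integral>\<^sup>+ s. ?f (x, s) \<partial>l x \<omega>) \<partial>lborel) =
        (\<integral>\<^sup>+ x. indicator C x * emeasure (lt x \<omega>) D \<partial>lborel)"
      by (rule nn_integral_cong_AE)
    moreover have "(\<integral>\<^sup>+ s. ?f (\<omega> s, s) \<partial>lborel) = (\<integral>\<^sup>+ s. indicator C (\<omega> s) * indicator D s \<partial>lborel)"
      by (intro nn_integral_cong) (auto simp: indicator_def)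
    ultimately show ?case using elim(1) by simp
  qed
qed

text \<open>Extends the occupation formula to integrands that depend on the path. The null set of a
  rectangle \<open>C \<times> D\<close> depends on the rectangle, but after multiplying by the
  indicator of a path event and integrating over \<open>P0\<close> it disappears, and such triple
  rectangles determine a measure.\<close>

lemma occupation:
  assumes f: "f \<in> borel_measurable ((path_space \<Otimes>\<^sub>M borel) \<Otimes>\<^sub>M borel)"
  shows "(\<integral>\<^sup>+ \<omega>. (\<integral>\<^sup>+ x. (\<integral>\<^sup>+ s. f ((\<omega>, x), s) \<partial>lt x \<omega>) \<partial>lborel) \<partial>P0) =
    (\<integral>\<^sup>+ \<omega>. (\<integral>\<^sup>+ s. f ((\<omega>, \<omega> s), s) \<partial>lborel) \<partial>P0)"
proof -
  let ?M = "P0 \<Otimes>\<^sub>M (lborel :: real measure)"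
  let ?N = "?M \<Otimes>\<^sub>M (borel :: real measure)"
  let ?K = "\<lambda>a. lt (snd a) (fst a)"
  \<comment> \<open>\<open>M1\<close> is the law of path, position and time with time spread by
    Lebesgue measure; \<open>M2\<close> is
    \<open>P0(d\<omega>) dx lt x \<omega> (ds)\<close>.\<close>
  define M1 where "M1 = distr ?M ?N (\<lambda>(\<omega>, s). ((\<omega>, \<omega> s), s))"
  define M2 where "M2 = mixture ?M ?N (\<lambda>a. distr (?K a) ?N (Pair a))"
  have K: "locally_finite_kernel ?M ?K"
    by (rule kernel_lt) measurable
  have ev: "(\<lambda>p. fst p (snd p)) \<in> borel_measurable ?M"
    by (rule measurable_path_apply[where f = fst and g = snd]) measurable
  have m1: "(\<lambda>(\<omega>, s). ((\<omega>, \<omega> s), s)) \<in> ?M \<rightarrow>\<^sub>M ?N"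
  proof -
    have "(\<lambda>p. fst p (snd p)) \<in> ?M \<rightarrow>\<^sub>M lborel" using ev by simp
    then have "(\<lambda>p. ((fst p, fst p (snd p)), snd p)) \<in> ?M \<rightarrow>\<^sub>M ?N"
      by (intro measurable_Pair measurable_fst) simp_all
    then show ?thesis by (simp add: case_prod_beta)
  qed
  have I1: "(\<integral>\<^sup>+ p. g p \<partial>M1) = (\<integral>\<^sup>+ \<omega>. (\<integral>\<^sup>+ s. g ((\<omega>, \<omega> s), s) \<partial>lborel) \<partial>P0)"
    if [measurable]: "g \<in> borel_measurable ?N" for g
    unfolding M1_def
    using nn_integral_distr[OF m1, of g] measurable_compose[OF m1 that]
    by (simp add: lborel.nn_integral_fst[symmetric] case_prod_beta)
  have I2: "(\<integral>\<^sup>+ p. g p \<partial>M2) = (\<integral>\<^sup>+ \<omega>. (\<integral>\<^sup>+ x. (\<integral>\<^sup>+ s. g ((\<omega>, x), s) \<partial>lt x \<omega>) \<partial>lborel) \<partial>P0)"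
    if [measurable]: "g \<in> borel_measurable ?N" for g
    unfolding M2_def nn_integral_mixture_section[OF K that]
    by (subst lborel.nn_integral_fst[symmetric]) simp_all
  let ?E1 = "{A \<times> C | A C. A \<in> sets P0 \<and> C \<in> sets (lborel :: real measure)}"
  let ?E = "{B \<times> D | B D. B \<in> ?E1 \<and> D \<in> sets (borel :: real measure)}"
  have E: "sets ?N = sigma_sets (space ?N) ?E"
  proof -
    have "sets ?N = sets (sigma (space ?M \<times> space (borel :: real measure)) ?E)"
    proof (rule sets_pair_eq)
      show "?E1 \<subseteq> Pow (space ?M)" using pair_measure_closed[of P0 lborel] by (simp add: space_pair_measure)
      show "sets ?M = sigma_sets (space ?M) ?E1" by (simp add: sets_pair_measure space_pair_measure)
      have "space P0 \<times> UNIV \<in> ?E1"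
        by (rule CollectI, rule exI, rule exI, rule conjI[OF refl], rule conjI[OF sets.top]) simp
      then show "{space ?M} \<subseteq> ?E1" by (simp add: space_pair_measure)
      show "sets borel = sigma_sets (space borel) (sets (borel :: real measure))"
        using sets.sigma_sets_eq[of "borel :: real measure"] by simp
      show "{UNIV} \<subseteq> sets (borel :: real measure)" by auto
    qed auto
    moreover have "?E \<subseteq> Pow (space ?N)"
      using pair_measure_closed[of P0 lborel] by (auto simp: space_pair_measure)
    ultimately show ?thesis by (simp add: space_pair_measure)
  qed
  have "M1 = M2"
  proof (rule measure_eqI_generator_eq[where E = ?E and \<Omega> = "space ?N" and
        A = "\<lambda>i. (space P0 \<times> UNIV) \<times> {- real i..real i}"])
    show "Int_stable ?E"
    proof (rule Int_stableI)
      fix a b assume "a \<in> ?E" "b \<in> ?E"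
      then obtain A C D A' C' D' where "a = (A \<times> C) \<times> D" "b = (A' \<times> C') \<times> D'"
        and "A \<in> sets P0" "C \<in> sets lborel" "D \<in> sets borel" "A' \<in> sets P0" "C' \<in> sets lborel" "D' \<in> sets borel"
        by auto
      then have "a \<inter> b = ((A \<inter> A') \<times> (C \<inter> C')) \<times> (D \<inter> D')"
        "A \<inter> A' \<in> sets P0" "C \<inter> C' \<in> sets lborel" "D \<inter> D' \<in> sets borel" by auto
      then show "a \<inter> b \<in> ?E" by blast
    qed
    show "?E \<subseteq> Pow (space ?N)"
      using pair_measure_closed[of P0 lborel] by (auto simp: space_pair_measure)
    show "sets M1 = sigma_sets (space ?N) ?E" "sets M2 = sigma_sets (space ?N) ?E"
      using E by (simp_all add: M1_def M2_def)
    show "range (\<lambda>i. (space P0 \<times> UNIV) \<times> {- real i..real i}) \<subseteq> ?E"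
    proof (rule image_subsetI, rule CollectI, rule exI, rule exI, rule conjI[OF refl], rule conjI)
      show "space P0 \<times> UNIV \<in> ?E1"
        by (rule CollectI, rule exI, rule exI, rule conjI[OF refl], rule conjI[OF sets.top]) simp
    qed simp
    show "(\<Union>i. (space P0 \<times> UNIV) \<times> {- real i..real i}) = space ?N"
      using UN_symmetric_intervals by (auto simp: space_pair_measure)
  next
    fix X assume "X \<in> ?E"
    then obtain A C D where X: "X = (A \<times> C) \<times> D"
      and m [measurable]: "A \<in> sets path_space" "C \<in> sets borel" "D \<in> sets borel" by auto
    have XN: "X \<in> sets ?N" unfolding X by measurable
    have ind: "indicator X ((\<omega>, x), s) = (indicator A \<omega> * (indicator C x * indicator D s) :: ennreal)" for \<omega> x s
      by (auto simp: X indicator_def)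
    have "emeasure M1 X = (\<integral>\<^sup>+ \<omega>. indicator A \<omega> * (\<integral>\<^sup>+ s. indicator C (\<omega> s) * indicator D s \<partial>lborel) \<partial>P0)"
    proof -
      have "emeasure M1 X = (\<integral>\<^sup>+ p. indicator X p \<partial>M1)"
        using XN by (simp add: M1_def)
      also have "\<dots> = (\<integral>\<^sup>+ \<omega>. (\<integral>\<^sup>+ s. indicator A \<omega> * (indicator C (\<omega> s) * indicator D s) \<partial>lborel) \<partial>P0)"
        using XN by (subst I1) (simp_all add: ind)
      also have "\<dots> = (\<integral>\<^sup>+ \<omega>. indicator A \<omega> * (\<integral>\<^sup>+ s. indicator C (\<omega> s) * indicator D s \<partial>lborel) \<partial>P0)"
      proof (rule nn_integral_cong, rule nn_integral_cmult)
        fix \<omega> assume "\<omega> \<in> space P0"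
        then have [measurable]: "\<omega> \<in> borel_measurable borel"
          by (auto simp: space_path_space intro: borel_measurable_continuous_onI)
        show "(\<lambda>s. indicator C (\<omega> s) * indicator D s :: ennreal) \<in> borel_measurable lborel" by measurable
      qed
      finally show ?thesis .
    qed
    also have "\<dots> = (\<integral>\<^sup>+ \<omega>. indicator A \<omega> * (\<integral>\<^sup>+ x. indicator C x * emeasure (lt x \<omega>) D \<partial>lborel) \<partial>P0)"
      using occupation_rectangle[OF m(2,3)] by (intro nn_integral_cong_AE) (auto elim!: eventually_mono)
    also have "\<dots> = emeasure M2 X"
    proof -
      have "emeasure M2 X = (\<integral>\<^sup>+ p. indicator X p \<partial>M2)"
        using XN by (simp add: M2_def)
      also have "\<dots> = (\<integral>\<^sup>+ \<omega>. (\<integral>\<^sup>+ x. (\<integral>\<^sup>+ s. indicator A \<omega> * (indicator C x * indicator D s) \<partial>lt x \<omega>) \<partial>lborel) \<partial>P0)"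
        using XN by (subst I2) (simp_all add: ind)
      also have "\<dots> = (\<integral>\<^sup>+ \<omega>. indicator A \<omega> * (\<integral>\<^sup>+ x. indicator C x * emeasure (lt x \<omega>) D \<partial>lborel) \<partial>P0)"
      proof (rule nn_integral_cong)
        fix \<omega> assume "\<omega> \<in> space P0"
        then have \<omega> [measurable]: "\<omega> \<in> space path_space" by simp
        have "(\<integral>\<^sup>+ s. indicator A \<omega> * (indicator C x * indicator D s) \<partial>lt x \<omega>) =
            indicator A \<omega> * (indicator C x * emeasure (lt x \<omega>) D)" for x
        proof -
          have "(\<integral>\<^sup>+ s. indicator D s \<partial>lt x \<omega>) = emeasure (lt x \<omega>) D"
            using sets_lt[OF \<omega>, of x] by simp
          moreover have "(\<integral>\<^sup>+ s. (indicator A \<omega> * indicator C x) * indicator D s \<partial>lt x \<omega>) =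
              (indicator A \<omega> * indicator C x) * (\<integral>\<^sup>+ s. indicator D s \<partial>lt x \<omega>)"
            by (rule nn_integral_cmult) (auto intro!: measurable_lt[OF \<omega>])
          ultimately show ?thesis by (simp only: mult.assoc)
        qed
        then show "(\<integral>\<^sup>+ x. (\<integral>\<^sup>+ s. indicator A \<omega> * (indicator C x * indicator D s) \<partial>lt x \<omega>) \<partial>lborel) =
            indicator A \<omega> * (\<integral>\<^sup>+ x. indicator C x * emeasure (lt x \<omega>) D \<partial>lborel)"
          by (simp only:) (rule nn_integral_cmult, measurable)
      qed
      finally show ?thesis by simp
    qed
    finally show "emeasure M1 X = emeasure M2 X" .
  next
    fix i :: nat
    \<comment> \<open>Only time has to be cut off: whatever the level, \<open>M1\<close> gives the
      box at most the length \<open>2 * real i\<close> of its time interval.\<close>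
    have m: "(space P0 \<times> UNIV) \<times> {- real i..real i} \<in> sets ?N" by measurable
    have "emeasure M1 ((space P0 \<times> UNIV) \<times> {- real i..real i}) =
        (\<integral>\<^sup>+ \<omega>. (\<integral>\<^sup>+ s. indicator ((space P0 \<times> UNIV) \<times> {- real i..real i}) ((\<omega>, \<omega> s), s) \<partial>lborel) \<partial>P0)"
      using m I1[of "indicator ((space P0 \<times> UNIV) \<times> {- real i..real i})"] by (simp add: M1_def)
    also have "\<dots> \<le> (\<integral>\<^sup>+ \<omega>. (\<integral>\<^sup>+ s. indicator {- real i..real i} s \<partial>lborel) \<partial>P0)"
      by (intro nn_integral_mono) (auto simp: indicator_def)
    also have "\<dots> = ennreal (2 * real i)" using emeasure_space_1 by simp
    finally show "emeasure M1 ((space P0 \<times> UNIV) \<times> {- real i..real i}) \<noteq> \<infinity>"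
      by (auto simp: top_unique)
  qed
  moreover have "f \<in> borel_measurable ?N" using f by measurable
  ultimately show ?thesis using I1[of f] I2[of f] by simp
qed

text \<open>The occupation formula replaces the level \<open>x\<close> by \<open>\<omega> s\<close>,
  so the path lowered by \<open>x\<close> and seen from \<open>s\<close> becomes the recentred path
  at time \<open>s\<close>. Time is then moved outside, because the recentred path is known to have
  law \<open>P0\<close> for each fixed \<open>s\<close>.\<close>

lemma Palm_lt0:
  assumes f: "f \<in> borel_measurable (path_space \<Otimes>\<^sub>M borel)"
  shows "(\<integral>\<^sup>+ \<omega>. (\<integral>\<^sup>+ s. f (path_shift s \<omega>, s) \<partial>lt0 \<omega>) \<partial>P) = (\<integral>\<^sup>+ \<omega>. (\<integral>\<^sup>+ s. f (\<omega>, s) \<partial>lborel) \<partial>P0)"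
proof -
  note [measurable] = f
  interpret pair_sigma_finite lborel P0 ..
  have lt0: "lt0 = lt 0" by (simp add: lt_def fun_eq_iff)
  have "(\<integral>\<^sup>+ \<omega>. (\<integral>\<^sup>+ s. f (path_shift s \<omega>, s) \<partial>lt0 \<omega>) \<partial>P) =
      (\<integral>\<^sup>+ \<omega>. (\<integral>\<^sup>+ x. (\<integral>\<^sup>+ s. f (path_shift s (path_add (- x) \<omega>), s) \<partial>lt x \<omega>) \<partial>lborel) \<partial>P0)"
    unfolding lt_def by (rule nn_integral_stationary_minus) (unfold lt0, measurable)
  also have "\<dots> = (\<integral>\<^sup>+ \<omega>. (\<integral>\<^sup>+ s. f (path_shift s (path_add (- \<omega> s) \<omega>), s) \<partial>lborel) \<partial>P0)"
  proof -
    have "(\<lambda>p. f (path_shift (snd p) (path_add (- snd (fst p)) (fst (fst p))), snd p))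
        \<in> borel_measurable ((path_space \<Otimes>\<^sub>M borel) \<Otimes>\<^sub>M borel)" by measurable
    from occupation[OF this] show ?thesis by simp
  qed
  also have "\<dots> = (\<integral>\<^sup>+ s. (\<integral>\<^sup>+ \<omega>. f (path_add (- \<omega> s) (path_shift s \<omega>), s) \<partial>P0) \<partial>lborel)"
    unfolding path_shift_add
  proof (rule Fubini')
    have "(\<lambda>p. snd p (fst p)) \<in> borel_measurable (lborel \<Otimes>\<^sub>M P0)"
      by (rule measurable_path_apply[where f = snd and g = fst]) measurable
    then have "(\<lambda>p. - snd p (fst p)) \<in> borel_measurable (lborel \<Otimes>\<^sub>M P0)"
      by (rule borel_measurable_uminus)
    then have "(\<lambda>p. path_add (- snd p (fst p)) (path_shift (fst p) (snd p))) \<in> lborel \<Otimes>\<^sub>M P0 \<rightarrow>\<^sub>M path_space"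
      by (rule measurable_path_add[rotated]) measurable
    then have "(\<lambda>p. (path_add (- snd p (fst p)) (path_shift (fst p) (snd p)), fst p))
        \<in> lborel \<Otimes>\<^sub>M P0 \<rightarrow>\<^sub>M path_space \<Otimes>\<^sub>M borel"
      by (rule measurable_Pair) measurable
    from measurable_compose[OF this f]
    show "(\<lambda>(s, \<omega>). f (path_add (- \<omega> s) (path_shift s \<omega>), s)) \<in> borel_measurable (lborel \<Otimes>\<^sub>M P0)"
      by (simp add: case_prod_beta)
  qed
  also have "\<dots> = (\<integral>\<^sup>+ s. (\<integral>\<^sup>+ \<omega>. f (\<omega>, s) \<partial>P0) \<partial>lborel)"
    by (intro nn_integral_cong nn_integral_P0_recentred_shift) measurable
  also have "\<dots> = (\<integral>\<^sup>+ \<omega>. (\<integral>\<^sup>+ s. f (\<omega>, s) \<partial>lborel) \<partial>P0)"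
    by (rule Fubini'[symmetric]) measurable
  finally show ?thesis .
qed

text \<open>\<open>P\<close> is invariant under vertical translation; lowering the path by
  \<open>y\<close> turns level \<open>y\<close> into level 0, and the height \<open>y\<close>
  reappears in the integrand.\<close>

lemma Palm_lt:
  assumes f: "f \<in> borel_measurable (path_space \<Otimes>\<^sub>M borel)"
  shows "(\<integral>\<^sup>+ \<omega>. (\<integral>\<^sup>+ s. f (path_shift s \<omega>, s) \<partial>lt y \<omega>) \<partial>P) =
    (\<integral>\<^sup>+ \<omega>. (\<integral>\<^sup>+ s. f (path_add y \<omega>, s) \<partial>lborel) \<partial>P0)"
proof -
  note [measurable] = f
  have lt0: "lt0 = lt 0" by (simp add: lt_def fun_eq_iff)
  have "(\<integral>\<^sup>+ \<omega>. (\<integral>\<^sup>+ s. f (path_shift s \<omega>, s) \<partial>lt y \<omega>) \<partial>P) =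
      (\<integral>\<^sup>+ \<omega>. (\<integral>\<^sup>+ s. f (path_add y (path_shift s \<omega>), s) \<partial>lt0 \<omega>) \<partial>P)"
  proof -
    have "(\<lambda>\<omega>. \<integral>\<^sup>+ s. f (path_add y (path_shift s \<omega>), s) \<partial>lt0 \<omega>) \<in> borel_measurable path_space"
      unfolding lt0 by measurable
    from nn_integral_stationary_path_add[OF this, of "- y"]
    show ?thesis by (simp add: path_shift_add lt_def)
  qed
  also have "\<dots> = (\<integral>\<^sup>+ \<omega>. (\<integral>\<^sup>+ s. f (path_add y \<omega>, s) \<partial>lborel) \<partial>P0)"
    using Palm_lt0[of "\<lambda>(\<omega>, s). f (path_add y \<omega>, s)"] by simp
  finally show ?thesis .
qed

section \<open>Mixtures of local times over the levels\<close>

definition lt_mix :: "real measure \<Rightarrow> (real \<Rightarrow> real) \<Rightarrow> real measure" where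
  "lt_mix \<nu> \<omega> = mixture \<nu> borel (\<lambda>x. lt x \<omega>)"

context
  fixes \<nu> :: "real measure"
  assumes prob_\<nu>: "prob_space \<nu>" and sets_\<nu> [measurable_cong, simp]: "sets \<nu> = sets borel"
begin

lemma nn_integral_lt_mix:
  assumes \<omega>: "\<omega> \<in> space path_space" and f: "f \<in> borel_measurable borel"
  shows "(\<integral>\<^sup>+ s. f s \<partial>lt_mix \<nu> \<omega>) = (\<integral>\<^sup>+ x. (\<integral>\<^sup>+ s. f s \<partial>lt x \<omega>) \<partial>\<nu>)"
  unfolding lt_mix_def
proof (rule nn_integral_mixture[OF _ _ f])
  note [measurable] = \<omega>
  show "(\<lambda>x. emeasure (lt x \<omega>) A) \<in> borel_measurable \<nu>" if "A \<in> sets borel" for A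
    by (rule borel_measurable_emeasure_lt) (use that in measurable)
qed (rule sets_lt[OF \<omega>])

lemma emeasure_lt_mix:
  assumes "\<omega> \<in> space path_space" and "C \<in> sets borel"
  shows "emeasure (lt_mix \<nu> \<omega>) C = (\<integral>\<^sup>+ x. emeasure (lt x \<omega>) C \<partial>\<nu>)"
  using nn_integral_lt_mix[OF assms(1), of "indicator C"] assms sets_lt[OF assms(1)]
  by (simp add: lt_mix_def)

text \<open>Here \<open>\<nu>\<close> may be singular, so knowing that Lebesgue-almost every level
  is good would not do. Translation invariance of \<open>P\<close> makes each single level bad only
  on a \<open>P\<close>-null set of paths, and Fubini then gives, for almost every path, that
  \<open>\<nu>\<close>-almost every level is good.\<close>

lemma AE_local_time_mix_eq: "AE \<omega> in P. local_time_mix l \<nu> \<omega> = lt_mix \<nu> \<omega>"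
proof -
  have "(\<integral>\<^sup>+ \<omega>. indicator infinite_set \<omega> \<partial>P) = 0"
    using AE_not_infinite_set by (subst nn_integral_0_iff_AE) (auto simp: indicator_def)
  then have "(\<integral>\<^sup>+ \<omega>. indicator infinite_set (path_add (- x) \<omega>) \<partial>P) = 0" for x
    by (subst nn_integral_stationary_path_add) auto
  then have "(\<integral>\<^sup>+ \<omega>. (\<integral>\<^sup>+ x. indicator infinite_set (path_add (- x) \<omega>) \<partial>\<nu>) \<partial>P) = 0"
    by (subst stationary_Fubini[OF prob_\<nu>]) auto
  then have "AE \<omega> in P. (\<integral>\<^sup>+ x. indicator infinite_set (path_add (- x) \<omega>) \<partial>\<nu>) = 0"
    using prob_\<nu> by (subst (asm) nn_integral_0_iff_AE) (auto simp: prob_space_imp_sigma_finite sigma_finite_measure.borel_measurable_nn_integral)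
  then show ?thesis using AE_space
  proof eventually_elim
    case (elim \<omega>)
    then have \<omega> [measurable]: "\<omega> \<in> space path_space" by simp
    have "(\<lambda>x. indicator infinite_set (path_add (- x) \<omega>) :: ennreal) \<in> borel_measurable \<nu>" by measurable
    with elim(1) have ae: "AE x in \<nu>. path_add (- x) \<omega> \<notin> infinite_set"
      by (subst (asm) nn_integral_0_iff_AE) (auto simp: indicator_def elim!: eventually_mono)
    show ?case
    proof (rule measure_eqI)
      show "sets (local_time_mix l \<nu> \<omega>) = sets (lt_mix \<nu> \<omega>)"
        by (simp add: local_time_mix_def lt_mix_def)
      fix C assume "C \<in> sets (local_time_mix l \<nu> \<omega>)"
      then have C: "C \<in> sets borel" by (simp add: local_time_mix_def)
      have "(\<integral>\<^sup>+ x. emeasure (l x \<omega>) C \<partial>\<nu>) = (\<integral>\<^sup>+ x. emeasure (lt x \<omega>) C \<partial>\<nu>)"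
        using ae by (intro nn_integral_cong_AE) (auto simp: lt_eq[OF \<omega>] elim!: eventually_mono)
      then show "emeasure (local_time_mix l \<nu> \<omega>) C = emeasure (lt_mix \<nu> \<omega>) C"
        using emeasure_local_time_mix[OF local_time \<omega> sets_\<nu> C] emeasure_lt_mix[OF \<omega> C] by simp
    qed
  qed
qed

lemma Palm_lt_mix:
  assumes f: "f \<in> borel_measurable (path_space \<Otimes>\<^sub>M borel)"
  shows "(\<integral>\<^sup>+ \<omega>. (\<integral>\<^sup>+ s. f (path_shift s \<omega>, s) \<partial>lt_mix \<nu> \<omega>) \<partial>P) =
    (\<integral>\<^sup>+ x. (\<integral>\<^sup>+ \<omega>. (\<integral>\<^sup>+ s. f (path_add x \<omega>, s) \<partial>lborel) \<partial>P0) \<partial>\<nu>)"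
proof -
  note [measurable] = f
  have "(\<integral>\<^sup>+ \<omega>. (\<integral>\<^sup>+ s. f (path_shift s \<omega>, s) \<partial>lt_mix \<nu> \<omega>) \<partial>P) =
      (\<integral>\<^sup>+ \<omega>. (\<integral>\<^sup>+ x. (\<integral>\<^sup>+ s. f (path_shift s \<omega>, s) \<partial>lt x \<omega>) \<partial>\<nu>) \<partial>P)"
  proof (rule nn_integral_cong)
    fix \<omega> assume "\<omega> \<in> space P"
    then have \<omega> [measurable]: "\<omega> \<in> space path_space" by simp
    show "(\<integral>\<^sup>+ s. f (path_shift s \<omega>, s) \<partial>lt_mix \<nu> \<omega>) =
        (\<integral>\<^sup>+ x. (\<integral>\<^sup>+ s. f (path_shift s \<omega>, s) \<partial>lt x \<omega>) \<partial>\<nu>)"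
      by (rule nn_integral_lt_mix[OF \<omega>]) measurable
  qed
  also have "\<dots> = (\<integral>\<^sup>+ x. (\<integral>\<^sup>+ \<omega>. (\<integral>\<^sup>+ s. f (path_shift s \<omega>, s) \<partial>lt x \<omega>) \<partial>P) \<partial>\<nu>)"
    by (rule stationary_Fubini[OF prob_\<nu>]) measurable
  finally show ?thesis by (simp add: Palm_lt[OF f])
qed

end

end

section \<open>Unbiased shifts and balancing allocations\<close>

text \<open>A countable generator is wanted, so that almost sure equalities on its members hold off
  one common null set. Half-open intervals are closed under intersection, up to being empty.\<close>

lemma sets_borel_rational_intervals:
  "sets borel = sigma_sets UNIV (range (\<lambda>(p, q). {real_of_rat p<..real_of_rat q}))" (is "_ = sigma_sets UNIV ?E")
proof
  have "{a<..} \<in> sigma_sets UNIV ?E" for a :: real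
  proof -
    have "{a<..} = (\<Union>(p, q)\<in>{(p, q). a < real_of_rat p}. {real_of_rat p<..real_of_rat q})"
    proof (intro equalityI subsetI)
      fix x assume "x \<in> {a<..}"
      then obtain p where "a < real_of_rat p" "real_of_rat p < x" using of_rat_dense by auto
      moreover obtain q where "x < real_of_rat q" "real_of_rat q < x + 1" using of_rat_dense[of x "x + 1"] by auto
      ultimately show "x \<in> (\<Union>(p, q)\<in>{(p, q). a < real_of_rat p}. {real_of_rat p<..real_of_rat q})"
        by (intro UN_I[of "(p, q)"]) simp_all
    qed auto
    also have "\<dots> \<in> sets (sigma UNIV ?E)"
      by (intro sets.countable_UN') (auto intro!: countableI_type)
    finally show ?thesis by simp
  qed
  then show "sets borel \<subseteq> sigma_sets UNIV ?E"
    unfolding borel_Ioi by (simp add: sigma_sets_mono image_subset_iff)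
  show "sigma_sets UNIV ?E \<subseteq> sets borel"
  proof -
    have "?E \<subseteq> sets borel" by auto
    from sets.sigma_sets_subset[OF this] show ?thesis by simp
  qed
qed

context canonical_BM
begin

section \<open>Unbiased shifts in terms of the law of the shifted path\<close>

definition shifted_law :: "((real \<Rightarrow> real) \<Rightarrow> real) \<Rightarrow> (real \<Rightarrow> real) measure" where
  "shifted_law T = distr P0 path_space (\<lambda>\<omega>. path_shift (T \<omega>) \<omega>)"

definition initial_law :: "real measure \<Rightarrow> (real \<Rightarrow> real) measure" where
  "initial_law \<nu> = distr (\<nu> \<Otimes>\<^sub>M P0) path_space (\<lambda>p. path_add (fst p) (snd p))"

context
  fixes T :: "(real \<Rightarrow> real) \<Rightarrow> real" and \<nu> :: "real measure"
  assumes T [measurable]: "T \<in> borel_measurable path_space"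
    and prob_\<nu>: "prob_space \<nu>" and sets_\<nu> [measurable_cong, simp]: "sets \<nu> = sets borel"
begin

interpretation \<nu>: prob_space \<nu> by (rule prob_\<nu>)

lemma space_\<nu>: "space \<nu> = UNIV"
  using sets_eq_imp_space_eq[OF sets_\<nu>] by simp

lemma nn_integral_shifted_law:
  assumes [measurable]: "f \<in> borel_measurable path_space"
  shows "(\<integral>\<^sup>+ \<omega>. f \<omega> \<partial>shifted_law T) = (\<integral>\<^sup>+ \<omega>. f (path_shift (T \<omega>) \<omega>) \<partial>P0)"
  unfolding shifted_law_def by (rule nn_integral_distr) measurable

lemma nn_integral_initial_law:
  assumes [measurable]: "f \<in> borel_measurable path_space"
  shows "(\<integral>\<^sup>+ \<omega>. f \<omega> \<partial>initial_law \<nu>) = (\<integral>\<^sup>+ x. (\<integral>\<^sup>+ \<omega>. f (path_add x \<omega>) \<partial>P0) \<partial>\<nu>)"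
proof -
  have "(\<integral>\<^sup>+ \<omega>. f \<omega> \<partial>initial_law \<nu>) = (\<integral>\<^sup>+ p. f (path_add (fst p) (snd p)) \<partial>(\<nu> \<Otimes>\<^sub>M P0))"
    unfolding initial_law_def by (rule nn_integral_distr) measurable
  also have "\<dots> = (\<integral>\<^sup>+ x. (\<integral>\<^sup>+ \<omega>. f (path_add x \<omega>) \<partial>P0) \<partial>\<nu>)"
    by (subst nn_integral_fst[symmetric]) simp_all
  finally show ?thesis .
qed

text \<open>A path amounts to its value at 0 together with the recentred path. For the path shifted
  by \<open>T\<close> this pair is \<open>(b \<omega>, X \<omega>)\<close>, and equality of the laws
  says that the pair has law \<open>\<nu> \<Otimes>\<^sub>M P0\<close>: independence, with
  \<open>\<nu>\<close> as law of \<open>b\<close> and Brownian motion as \<open>X\<close>.\<close>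

lemma unbiased_shift_embeds_iff:
  "unbiased_shift P0 T \<and> embeds P0 T \<nu> \<longleftrightarrow> shifted_law T = initial_law \<nu>"
proof -
  define b where "b = (\<lambda>\<omega> :: real \<Rightarrow> real. \<omega> (T \<omega>))"
  define X where "X = (\<lambda>\<omega> t. \<omega> (T \<omega> + t) - \<omega> (T \<omega>))"
  have X_eq: "X \<omega> = path_add (- b \<omega>) (path_shift (T \<omega>) \<omega>)" for \<omega>
    by (simp add: X_def b_def path_add_def path_shift_def)
  have b: "b \<in> borel_measurable P0"
    unfolding b_def by (rule measurable_path_apply[where f = "\<lambda>\<omega>. \<omega>" and g = T]) measurable
  have X: "X \<in> P0 \<rightarrow>\<^sub>M path_space"
    unfolding X_eq[abs_def] by (rule measurable_path_add[OF _ borel_measurable_uminus[OF b]]) measurable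
  have bX: "(\<lambda>\<omega>. (b \<omega>, X \<omega>)) \<in> P0 \<rightarrow>\<^sub>M \<nu> \<Otimes>\<^sub>M P0"
    using b X by (intro measurable_Pair) (simp_all cong: measurable_cong_sets)
  have joint: "emeasure (distr P0 (\<nu> \<Otimes>\<^sub>M P0) (\<lambda>\<omega>. (b \<omega>, X \<omega>))) (B \<times> A) =
      emeasure P0 ((X -` A \<inter> space P0) \<inter> (b -` B \<inter> space P0))"
    if "A \<in> sets path_space" "B \<in> sets borel" for A B
    using that emeasure_distr[OF bX, of "B \<times> A"] by (auto intro!: arg_cong[where f = "emeasure P0"])
  have unbiased: "unbiased_shift P0 T \<longleftrightarrow> two_sided_BM P0 X \<and> indep_rvs P0 path_space X borel b"
    by (simp add: unbiased_shift_def X_def b_def)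
  have embeds: "embeds P0 T \<nu> \<longleftrightarrow> distr P0 borel b = \<nu>"
    by (simp add: embeds_def b_def)
  show ?thesis
  proof
    assume "unbiased_shift P0 T \<and> embeds P0 T \<nu>"
    then have BM: "two_sided_BM P0 X" and indep: "indep_rvs P0 path_space X borel b"
      and \<nu>: "distr P0 borel b = \<nu>"
      by (simp_all add: unbiased embeds)
    have "distr P0 path_space X = distr P0 path_space (\<lambda>\<omega>. \<omega>)"
      using BM two_sided_BM_P0 by (rule two_sided_BM_law_unique)
    then have lawX: "distr P0 path_space X = P0" by (simp add: distr_id2)
    have "\<nu> \<Otimes>\<^sub>M P0 = distr P0 (\<nu> \<Otimes>\<^sub>M P0) (\<lambda>\<omega>. (b \<omega>, X \<omega>))"
    proof (rule pair_measure_eqI)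
      show "sigma_finite_measure \<nu>" "sigma_finite_measure P0" by unfold_locales
      fix B A assume "B \<in> sets \<nu>" "A \<in> sets P0"
      then have AB: "A \<in> sets path_space" "B \<in> sets borel" by simp_all
      have "prob ((X -` A \<inter> space P0) \<inter> (b -` B \<inter> space P0)) = prob (X -` A \<inter> space P0) * prob (b -` B \<inter> space P0)"
        using indep AB unfolding indep_rvs_def indep_sets2_eq by blast
      moreover have "emeasure \<nu> B = emeasure P0 (b -` B \<inter> space P0)"
        using emeasure_distr[OF b AB(2)] \<nu> by simp
      moreover have "emeasure P0 A = emeasure P0 (X -` A \<inter> space P0)"
        using emeasure_distr[OF X AB(1)] lawX by simp
      ultimately show "emeasure \<nu> B * emeasure P0 A = emeasure (distr P0 (\<nu> \<Otimes>\<^sub>M P0) (\<lambda>\<omega>. (b \<omega>, X \<omega>))) (B \<times> A)"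
        unfolding joint[OF AB] by (simp add: emeasure_eq_measure ennreal_mult mult.commute)
    qed simp
    then have "initial_law \<nu> = distr (distr P0 (\<nu> \<Otimes>\<^sub>M P0) (\<lambda>\<omega>. (b \<omega>, X \<omega>))) path_space (\<lambda>p. path_add (fst p) (snd p))"
      by (simp add: initial_law_def)
    also have "\<dots> = distr P0 path_space (\<lambda>\<omega>. path_add (b \<omega>) (X \<omega>))"
      by (subst distr_distr[OF _ bX]) (simp_all add: comp_def)
    also have "\<dots> = shifted_law T"
      by (simp add: X_eq shifted_law_def)
    finally show "shifted_law T = initial_law \<nu>" ..
  next
    assume eq: "shifted_law T = initial_law \<nu>"
    \<comment> \<open>Undoes \<open>path_add x \<omega>\<close> for paths with
      \<open>\<omega> 0 = 0\<close>. These have full measure under \<open>P0\<close>, so the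
      composition is the identity almost everywhere. On the path shifted by \<open>T\<close> it
      yields exactly \<open>(b \<omega>, X \<omega>)\<close>.\<close>
    define \<Phi> where "\<Phi> = (\<lambda>\<omega> :: real \<Rightarrow> real. (\<omega> 0, path_add (- \<omega> 0) \<omega>))"
    have \<Phi>: "\<Phi> \<in> path_space \<rightarrow>\<^sub>M \<nu> \<Otimes>\<^sub>M P0"
    proof -
      have "(\<lambda>\<omega>. \<omega> 0) \<in> path_space \<rightarrow>\<^sub>M \<nu>"
        using measurable_path_eval[of 0] by (simp cong: measurable_cong_sets)
      moreover have "(\<lambda>\<omega>. path_add (- \<omega> 0) \<omega>) \<in> path_space \<rightarrow>\<^sub>M P0"
        using measurable_path_add[OF measurable_ident borel_measurable_uminus[OF measurable_path_eval[of 0]]]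
        by (simp cong: measurable_cong_sets)
      ultimately show ?thesis unfolding \<Phi>_def by (rule measurable_Pair)
    qed
    have "distr P0 (\<nu> \<Otimes>\<^sub>M P0) (\<lambda>\<omega>. (b \<omega>, X \<omega>)) = distr (shifted_law T) (\<nu> \<Otimes>\<^sub>M P0) \<Phi>"
    proof -
      have "(\<lambda>\<omega>. path_shift (T \<omega>) \<omega>) \<in> P0 \<rightarrow>\<^sub>M path_space" by measurable
      from distr_distr[OF \<Phi> this] show ?thesis
        by (simp add: shifted_law_def comp_def \<Phi>_def X_eq b_def path_shift_def)
    qed
    also have "\<dots> = distr (\<nu> \<Otimes>\<^sub>M P0) (\<nu> \<Otimes>\<^sub>M P0) (\<lambda>p. \<Phi> (path_add (fst p) (snd p)))"
    proof -
      have "(\<lambda>p. path_add (fst p) (snd p)) \<in> \<nu> \<Otimes>\<^sub>M P0 \<rightarrow>\<^sub>M path_space" by measurable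
      from distr_distr[OF \<Phi> this] show ?thesis
        by (simp add: eq initial_law_def comp_def)
    qed
    also have "\<dots> = distr (\<nu> \<Otimes>\<^sub>M P0) (\<nu> \<Otimes>\<^sub>M P0) (\<lambda>p. p)"
    proof (rule distr_cong_AE)
      interpret pair_sigma_finite \<nu> P0 ..
      have "(\<lambda>p. snd p 0) \<in> borel_measurable (\<nu> \<Otimes>\<^sub>M P0)"
        using measurable_compose[OF measurable_snd, of "\<lambda>\<omega>. \<omega> 0" P0 borel \<nu>] measurable_path_eval[of 0]
        by (simp cong: measurable_cong_sets)
      then have "{p \<in> space (\<nu> \<Otimes>\<^sub>M P0). snd p 0 = 0} \<in> sets (\<nu> \<Otimes>\<^sub>M P0)" by measurable
      moreover have "AE x in \<nu>. AE \<omega> in P0. snd (x, \<omega>) 0 = 0"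
        using two_sided_BM_P0 by (simp add: two_sided_BM_def)
      ultimately have "AE p in \<nu> \<Otimes>\<^sub>M P0. snd p 0 = 0"
        by (rule AE_pair_measure)
      then show "AE p in \<nu> \<Otimes>\<^sub>M P0. \<Phi> (path_add (fst p) (snd p)) = p"
        by eventually_elim (simp add: \<Phi>_def path_add_def)
      have "(\<lambda>p. path_add (fst p) (snd p)) \<in> \<nu> \<Otimes>\<^sub>M P0 \<rightarrow>\<^sub>M path_space" by measurable
      then show "(\<lambda>p. \<Phi> (path_add (fst p) (snd p))) \<in> \<nu> \<Otimes>\<^sub>M P0 \<rightarrow>\<^sub>M \<nu> \<Otimes>\<^sub>M P0"
        using \<Phi> by (rule measurable_compose)
    qed simp_all
    also have "\<dots> = \<nu> \<Otimes>\<^sub>M P0" by (rule distr_id2) simp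
    finally have law: "distr P0 (\<nu> \<Otimes>\<^sub>M P0) (\<lambda>\<omega>. (b \<omega>, X \<omega>)) = \<nu> \<Otimes>\<^sub>M P0" .
    have prod: "emeasure P0 ((X -` A \<inter> space P0) \<inter> (b -` B \<inter> space P0)) = emeasure \<nu> B * emeasure P0 A"
      if "A \<in> sets path_space" "B \<in> sets borel" for A B
      using joint[OF that] that by (simp add: law emeasure_pair_measure_Times)
    \<comment> \<open>The marginals follow by taking the whole space as the other factor, both
      \<open>\<nu>\<close> and \<open>P0\<close> having mass 1.\<close>
    have lawX: "emeasure P0 (X -` A \<inter> space P0) = emeasure P0 A" if "A \<in> sets path_space" for A
      using prod[OF that, of UNIV] \<nu>.emeasure_space_1 by (simp add: space_\<nu> Int_absorb2)
    have lawb: "emeasure P0 (b -` B \<inter> space P0) = emeasure \<nu> B" if "B \<in> sets borel" for B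
    proof -
      have "X -` space path_space \<inter> space P0 = space P0" using measurable_space[OF X] by auto
      then show ?thesis
        using prod[OF sets.top that] emeasure_space_1 by (simp add: Int_absorb1)
    qed
    have "two_sided_BM P0 X"
    proof (rule two_sided_BM_of_law[OF brownian _ X])
      show "prob_space P0" by unfold_locales
      show "distr P0 path_space X = P0"
        by (rule measure_eqI) (simp_all add: emeasure_distr[OF X] lawX del: space_P0)
    qed
    moreover have "distr P0 borel b = \<nu>"
      by (rule measure_eqI) (simp_all add: emeasure_distr[OF b] lawb del: space_P0)
    moreover have "indep_rvs P0 path_space X borel b"
      unfolding indep_rvs_def indep_sets2_eq
    proof (intro conjI ballI X b)
      show "{X -` A \<inter> space P0 |A. A \<in> sets path_space} \<subseteq> events"
        using measurable_sets[OF X] by blast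
      show "{b -` B \<inter> space P0 |B. B \<in> sets borel} \<subseteq> events"
        using measurable_sets[OF b] by blast
      fix U V assume "U \<in> {X -` A \<inter> space P0 |A. A \<in> sets path_space}" "V \<in> {b -` B \<inter> space P0 |B. B \<in> sets borel}"
      then obtain A B where UV: "U = X -` A \<inter> space P0" "V = b -` B \<inter> space P0"
        and AB: "A \<in> sets path_space" "B \<in> sets borel" by blast
      have "emeasure P0 (U \<inter> V) = emeasure P0 U * emeasure P0 V"
        using prod[OF AB] lawX[OF AB(1)] lawb[OF AB(2)] unfolding UV by (simp add: mult.commute)
      then show "prob (U \<inter> V) = prob U * prob V"
        by (simp add: measure_def enn2real_mult)
    qed
    ultimately show "unbiased_shift P0 T \<and> embeds P0 T \<nu>"
      by (simp add: unbiased embeds)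
  qed
qed

end

end

context BM_local_time
begin

context
  fixes T :: "(real \<Rightarrow> real) \<Rightarrow> real" and \<nu> :: "real measure"
  assumes T [measurable]: "T \<in> borel_measurable path_space"
    and prob_\<nu>: "prob_space \<nu>" and sets_\<nu> [measurable_cong, simp]: "sets \<nu> = sets borel"
begin

interpretation \<nu>: prob_space \<nu> by (rule prob_\<nu>)

section \<open>The image of the local time under the allocation\<close>

lemma measurable_allocation_of:
  "(\<lambda>p. allocation_of T (fst p) (snd p)) \<in> borel_measurable (path_space \<Otimes>\<^sub>M borel)"
  unfolding allocation_of_def by measurable

lemma measurable_allocation_of_path:
  assumes [measurable]: "\<omega> \<in> space path_space"
  shows "allocation_of T \<omega> \<in> borel_measurable borel"
  unfolding allocation_of_def[abs_def] by measurable

definition transported :: "(real \<Rightarrow> real) \<Rightarrow> real measure" where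
  "transported \<omega> = distr (lt0 \<omega>) borel (allocation_of T \<omega>)"

lemma nn_integral_transported:
  assumes \<omega>: "\<omega> \<in> space path_space" and f: "f \<in> borel_measurable borel"
  shows "(\<integral>\<^sup>+ s. f s \<partial>transported \<omega>) = (\<integral>\<^sup>+ s. f (allocation_of T \<omega> s) \<partial>lt0 \<omega>)"
proof -
  have "allocation_of T \<omega> \<in> borel_measurable (lt 0 \<omega>)"
    using measurable_allocation_of_path[OF \<omega>] by (rule measurable_lt[OF \<omega>])
  then show ?thesis
    unfolding transported_def using f by (intro nn_integral_distr) (simp_all add: lt_def)
qed

text \<open>Shifting \<open>\<omega>\<close> to the new location
  \<open>T (path_shift s \<omega>) + s\<close> is the same as applying the shift by \<open>T\<close>
  to \<open>path_shift s \<omega>\<close>, so the integrand is again a function of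
  \<open>path_shift s \<omega>\<close> and \<open>s\<close>, and the Palm formula at level 0
  applies. The time offset \<open>T \<omega>\<close> left over is absorbed by translation invariance
  of Lebesgue measure.\<close>

lemma Palm_transported:
  assumes f: "f \<in> borel_measurable (path_space \<Otimes>\<^sub>M borel)"
  shows "(\<integral>\<^sup>+ \<omega>. (\<integral>\<^sup>+ s. f (path_shift s \<omega>, s) \<partial>transported \<omega>) \<partial>P) =
    (\<integral>\<^sup>+ \<omega>. (\<integral>\<^sup>+ s. f (\<omega>, s) \<partial>lborel) \<partial>shifted_law T)"
proof -
  note [measurable] = f
  have "(\<integral>\<^sup>+ \<omega>. (\<integral>\<^sup>+ s. f (path_shift s \<omega>, s) \<partial>transported \<omega>) \<partial>P) =
      (\<integral>\<^sup>+ \<omega>. (\<integral>\<^sup>+ s. f (path_shift (T (path_shift s \<omega>)) (path_shift s \<omega>), T (path_shift s \<omega>) + s) \<partial>lt0 \<omega>) \<partial>P)"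
  proof (rule nn_integral_cong)
    fix \<omega> assume "\<omega> \<in> space P"
    then have \<omega> [measurable]: "\<omega> \<in> space path_space" by simp
    have "(\<lambda>s. f (path_shift s \<omega>, s)) \<in> borel_measurable borel" by measurable
    from nn_integral_transported[OF \<omega> this]
    show "(\<integral>\<^sup>+ s. f (path_shift s \<omega>, s) \<partial>transported \<omega>) =
        (\<integral>\<^sup>+ s. f (path_shift (T (path_shift s \<omega>)) (path_shift s \<omega>), T (path_shift s \<omega>) + s) \<partial>lt0 \<omega>)"
      by (simp add: allocation_of_def)
  qed
  also have "\<dots> = (\<integral>\<^sup>+ \<omega>. (\<integral>\<^sup>+ s. f (path_shift (T \<omega>) \<omega>, T \<omega> + s) \<partial>lborel) \<partial>P0)"
  proof -
    have "(\<lambda>p. f (path_shift (T (fst p)) (fst p), T (fst p) + snd p)) \<in> borel_measurable (path_space \<Otimes>\<^sub>M borel)"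
      by measurable
    from Palm_lt0[OF this] show ?thesis by simp
  qed
  also have "\<dots> = (\<integral>\<^sup>+ \<omega>. (\<integral>\<^sup>+ s. f (path_shift (T \<omega>) \<omega>, s) \<partial>lborel) \<partial>P0)"
  proof (rule nn_integral_cong)
    fix \<omega> assume "\<omega> \<in> space P0"
    then have \<omega> [measurable]: "\<omega> \<in> space path_space" by simp
    have [measurable]: "path_shift (T \<omega>) \<omega> \<in> space path_space" by (rule path_shift_in_space[OF \<omega>])
    show "(\<integral>\<^sup>+ s. f (path_shift (T \<omega>) \<omega>, T \<omega> + s) \<partial>lborel) = (\<integral>\<^sup>+ s. f (path_shift (T \<omega>) \<omega>, s) \<partial>lborel)"
      by (rule nn_integral_lborel_translate) measurable
  qed
  also have "\<dots> = (\<integral>\<^sup>+ \<omega>. (\<integral>\<^sup>+ s. f (\<omega>, s) \<partial>lborel) \<partial>shifted_law T)"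
    by (rule nn_integral_shifted_law[OF T prob_\<nu> sets_\<nu>, symmetric]) measurable
  finally show ?thesis .
qed

lemma Palm_lt_mix_initial_law:
  assumes f: "f \<in> borel_measurable (path_space \<Otimes>\<^sub>M borel)"
  shows "(\<integral>\<^sup>+ \<omega>. (\<integral>\<^sup>+ s. f (path_shift s \<omega>, s) \<partial>lt_mix \<nu> \<omega>) \<partial>P) =
    (\<integral>\<^sup>+ \<omega>. (\<integral>\<^sup>+ s. f (\<omega>, s) \<partial>lborel) \<partial>initial_law \<nu>)"
proof -
  note [measurable] = f
  have "(\<lambda>\<omega>. \<integral>\<^sup>+ s. f (\<omega>, s) \<partial>lborel) \<in> borel_measurable path_space" by measurable
  from nn_integral_initial_law[OF T prob_\<nu> sets_\<nu> this] show ?thesis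
    using Palm_lt_mix[OF prob_\<nu> sets_\<nu> f] by simp
qed

lemma shifted_law_eq_of_transported:
  assumes "AE \<omega> in P. transported \<omega> = lt_mix \<nu> \<omega>"
  shows "shifted_law T = initial_law \<nu>"
proof (rule measure_eqI)
  show "sets (shifted_law T) = sets (initial_law \<nu>)"
    by (simp add: shifted_law_def initial_law_def)
  fix A assume "A \<in> sets (shifted_law T)"
  then have A [measurable]: "A \<in> sets path_space" by (simp add: shifted_law_def)
  \<comment> \<open>The time window has length 1, so integrating out \<open>s\<close> leaves the
    indicator of \<open>A\<close>.\<close>
  define f where "f = (\<lambda>p :: (real \<Rightarrow> real) \<times> real. indicator A (fst p) * indicator {0..1} (snd p) :: ennreal)"
  have f: "f \<in> borel_measurable (path_space \<Otimes>\<^sub>M borel)" unfolding f_def by measurable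
  have I: "(\<integral>\<^sup>+ s. f (\<omega>, s) \<partial>lborel) = indicator A \<omega>" for \<omega>
    by (simp add: f_def nn_integral_cmult)
  have "emeasure (shifted_law T) A = (\<integral>\<^sup>+ \<omega>. (\<integral>\<^sup>+ s. f (\<omega>, s) \<partial>lborel) \<partial>shifted_law T)"
    unfolding I using A by (simp add: shifted_law_def)
  also have "\<dots> = (\<integral>\<^sup>+ \<omega>. (\<integral>\<^sup>+ s. f (path_shift s \<omega>, s) \<partial>transported \<omega>) \<partial>P)"
    by (rule Palm_transported[OF f, symmetric])
  also have "\<dots> = (\<integral>\<^sup>+ \<omega>. (\<integral>\<^sup>+ s. f (path_shift s \<omega>, s) \<partial>lt_mix \<nu> \<omega>) \<partial>P)"
    using assms by (intro nn_integral_cong_AE) (auto elim!: eventually_mono)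
  also have "\<dots> = (\<integral>\<^sup>+ \<omega>. (\<integral>\<^sup>+ s. f (\<omega>, s) \<partial>lborel) \<partial>initial_law \<nu>)"
    by (rule Palm_lt_mix_initial_law[OF f])
  also have "\<dots> = emeasure (initial_law \<nu>) A"
    unfolding I using A by (simp add: initial_law_def)
  finally show "emeasure (shifted_law T) A = emeasure (initial_law \<nu>) A" .
qed

lemma transported_eq_of_shifted_law:
  assumes eq: "shifted_law T = initial_law \<nu>"
  shows "AE \<omega> in P. transported \<omega> = lt_mix \<nu> \<omega>"
proof -
  text \<open>The Palm measure of a random measure determines its integrals against \<open>P\<close>, because the
    integrand \<open>h (\<omega>, s)\<close> can be written as a function of \<open>(path_shift s \<omega>, s)\<close>.\<close>
  have key: "(\<integral>\<^sup>+ \<omega>. (\<integral>\<^sup>+ s. h (\<omega>, s) \<partial>transported \<omega>) \<partial>P) = (\<integral>\<^sup>+ \<omega>. (\<integral>\<^sup>+ s. h (\<omega>, s) \<partial>lt_mix \<nu> \<omega>) \<partial>P)"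
    if [measurable]: "h \<in> borel_measurable (path_space \<Otimes>\<^sub>M borel)" for h
  proof -
    have f: "(\<lambda>p. h (path_shift (- snd p) (fst p), snd p)) \<in> borel_measurable (path_space \<Otimes>\<^sub>M borel)"
      by measurable
    show ?thesis
      using Palm_transported[OF f] Palm_lt_mix_initial_law[OF f] eq by simp
  qed
  have ae: "AE \<omega> in P. emeasure (transported \<omega>) C = emeasure (lt_mix \<nu> \<omega>) C \<and> emeasure (lt_mix \<nu> \<omega>) C \<noteq> \<infinity>"
    if C: "C = {a<..b}" for C and a b :: real
  proof -
    have [measurable]: "C \<in> sets borel" by (simp add: C)
    have k1: "(\<lambda>\<omega>. emeasure (transported \<omega>) C) \<in> borel_measurable P"
    proof -
      have "(\<lambda>p. indicator C (allocation_of T (fst p) (snd p)) :: ennreal) \<in> borel_measurable (path_space \<Otimes>\<^sub>M borel)"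
        using measurable_compose[OF measurable_allocation_of, of "indicator C :: real \<Rightarrow> ennreal"] by simp
      from borel_measurable_nn_integral_section[OF kernel_lt0 this]
      have "(\<lambda>\<omega>. \<integral>\<^sup>+ s. indicator C (allocation_of T \<omega> s) \<partial>lt0 \<omega>) \<in> borel_measurable path_space"
        by simp
      then have "(\<lambda>\<omega>. emeasure (transported \<omega>) C) \<in> borel_measurable path_space"
      proof (rule measurable_eqI)
        fix \<omega> assume "\<omega> \<in> space path_space"
        from nn_integral_transported[OF this, of "indicator C"]
        show "emeasure (transported \<omega>) C = (\<integral>\<^sup>+ s. indicator C (allocation_of T \<omega> s) \<partial>lt0 \<omega>)"
          by (simp add: transported_def)
      qed
      then show ?thesis by simp
    qed
    have k2: "(\<lambda>\<omega>. emeasure (lt_mix \<nu> \<omega>) C) \<in> borel_measurable P"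
    proof -
      have "(\<lambda>p. emeasure (lt (snd p) (fst p)) C) \<in> borel_measurable (path_space \<Otimes>\<^sub>M \<nu>)"
        by (rule borel_measurable_emeasure_lt) measurable
      then have "(\<lambda>\<omega>. \<integral>\<^sup>+ x. emeasure (lt x \<omega>) C \<partial>\<nu>) \<in> borel_measurable path_space"
        using \<nu>.borel_measurable_nn_integral[of "\<lambda>\<omega> x. emeasure (lt x \<omega>) C" path_space]
        by (simp add: case_prod_beta')
      then have "(\<lambda>\<omega>. emeasure (lt_mix \<nu> \<omega>) C) \<in> borel_measurable path_space"
        by (rule measurable_eqI) (simp add: emeasure_lt_mix[OF prob_\<nu> sets_\<nu>])
      then show ?thesis by simp
    qed
    \<comment> \<open>With an integrand depending on time only, \<open>P0\<close> and
      \<open>\<nu>\<close> contribute mass 1 each, so the intensity is Lebesgue measure and is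
      finite on the bounded interval \<open>C\<close>.\<close>
    have "(\<lambda>p. indicator C (snd p) :: ennreal) \<in> borel_measurable (path_space \<Otimes>\<^sub>M borel)" by measurable
    from Palm_lt_mix[OF prob_\<nu> sets_\<nu> this]
    have "(\<integral>\<^sup>+ \<omega>. emeasure (lt_mix \<nu> \<omega>) C \<partial>P) = emeasure lborel C"
      using emeasure_space_1 \<nu>.emeasure_space_1 by (simp add: lt_mix_def)
    then have fin: "(\<integral>\<^sup>+ \<omega>. emeasure (lt_mix \<nu> \<omega>) C \<partial>P) \<noteq> \<infinity>"
      by (cases "a \<le> b") (simp_all add: C)
    \<comment> \<open>Testing \<open>key\<close> with the indicator of \<open>A\<close> times that
      of \<open>C\<close> shows that the two masses of \<open>C\<close> are densities of the same
      measure with respect to \<open>P\<close>; a density of finite integral is unique almost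
      everywhere.\<close>
    have "density P (\<lambda>\<omega>. emeasure (lt_mix \<nu> \<omega>) C) = density P (\<lambda>\<omega>. emeasure (transported \<omega>) C)"
    proof (rule measure_eqI)
      fix A assume "A \<in> sets (density P (\<lambda>\<omega>. emeasure (lt_mix \<nu> \<omega>) C))"
      then have A [measurable]: "A \<in> sets path_space" by simp
      have h: "(\<lambda>p. indicator A (fst p) * indicator C (snd p) :: ennreal) \<in> borel_measurable (path_space \<Otimes>\<^sub>M borel)"
        by measurable
      have "(\<integral>\<^sup>+ s. indicator A \<omega> * indicator C s \<partial>M) = emeasure M C * indicator A \<omega>"
        if "sets M = sets borel" for M and \<omega> :: "real \<Rightarrow> real"
        using that nn_integral_cmult[of "indicator C" M "indicator A \<omega>"]
        by (simp add: mult.commute cong: measurable_cong_sets)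
      then show "emeasure (density P (\<lambda>\<omega>. emeasure (lt_mix \<nu> \<omega>) C)) A =
          emeasure (density P (\<lambda>\<omega>. emeasure (transported \<omega>) C)) A"
        using key[OF h] A k1 k2 by (simp add: emeasure_density lt_mix_def transported_def)
    qed simp
    then have "AE \<omega> in P. emeasure (lt_mix \<nu> \<omega>) C = emeasure (transported \<omega>) C"
      using finite_density_unique[OF k2 k1 _ _ fin] by simp
    moreover have "AE \<omega> in P. emeasure (lt_mix \<nu> \<omega>) C \<noteq> \<infinity>"
      by (rule nn_integral_PInf_AE[OF k2 fin])
    ultimately show ?thesis by eventually_elim simp
  qed
  \<comment> \<open>Countably many intervals leave one null set for all of them. The finiteness part
    is kept because the uniqueness theorem needs an exhausting sequence of sets of finite
    mass.\<close>
  have "AE \<omega> in P. \<forall>p q. emeasure (transported \<omega>) {real_of_rat p<..real_of_rat q} =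
      emeasure (lt_mix \<nu> \<omega>) {real_of_rat p<..real_of_rat q} \<and>
      emeasure (lt_mix \<nu> \<omega>) {real_of_rat p<..real_of_rat q} \<noteq> \<infinity>"
    unfolding AE_all_countable using ae[OF refl] by blast
  then show ?thesis
  proof eventually_elim
    case (elim \<omega>)
    let ?E = "range (\<lambda>(p, q). {real_of_rat p<..real_of_rat q})"
    show ?case
    proof (rule measure_eqI_generator_eq[where E = ?E and \<Omega> = UNIV and
          A = "\<lambda>i :: nat. {real_of_rat (- of_nat i)<..real_of_rat (of_nat i)}"])
      show "Int_stable ?E"
      proof (rule Int_stableI)
        fix U V assume "U \<in> ?E" "V \<in> ?E"
        then obtain p q p' q' where "U = {real_of_rat p<..real_of_rat q}" "V = {real_of_rat p'<..real_of_rat q'}"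
          by auto
        then have "U \<inter> V = {real_of_rat (max p p')<..real_of_rat (min q q')}"
          by (auto simp: max_def min_def of_rat_less_eq)
        then show "U \<inter> V \<in> ?E" by auto
      qed
      show "sets (transported \<omega>) = sigma_sets UNIV ?E" "sets (lt_mix \<nu> \<omega>) = sigma_sets UNIV ?E"
        by (simp_all add: transported_def lt_mix_def sets_borel_rational_intervals)
      show "(\<Union>i :: nat. {real_of_rat (- of_nat i)<..real_of_rat (of_nat i)}) = UNIV"
      proof (intro equalityI subsetI UNIV_I)
        fix x :: real
        obtain n :: nat where "\<bar>x\<bar> < real n" using reals_Archimedean2 by blast
        then show "x \<in> (\<Union>i :: nat. {real_of_rat (- of_nat i)<..real_of_rat (of_nat i)})"
          by (auto simp: of_rat_minus abs_less_iff intro!: exI[of _ n])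
      qed
      show "range (\<lambda>i :: nat. {real_of_rat (- of_nat i)<..real_of_rat (of_nat i)}) \<subseteq> ?E"
        by (rule image_subsetI) (rule rev_image_eqI[OF UNIV_I], rule case_prod_conv[symmetric])
      show "emeasure (transported \<omega>) {real_of_rat (- of_nat i)<..real_of_rat (of_nat i)} \<noteq> \<infinity>" for i :: nat
        using elim by metis
    qed (use elim in auto)
  qed
qed

lemma balances_iff:
  "balances P (allocation_of T) (l 0) (local_time_mix l \<nu>) \<longleftrightarrow> shifted_law T = initial_law \<nu>"
proof -
  have lt0: "AE \<omega> in P. l 0 \<omega> = lt0 \<omega>"
    using AE_not_infinite_set AE_space by eventually_elim (simp add: lt0_eq)
  note mix = AE_local_time_mix_eq[OF prob_\<nu> sets_\<nu>]
  have "balances P (allocation_of T) (l 0) (local_time_mix l \<nu>) \<longleftrightarrow> (AE \<omega> in P. transported \<omega> = lt_mix \<nu> \<omega>)"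
    unfolding balances_def transported_def
  proof
    assume "AE \<omega> in P. distr (l 0 \<omega>) borel (allocation_of T \<omega>) = local_time_mix l \<nu> \<omega>"
    with lt0 mix show "AE \<omega> in P. distr (lt0 \<omega>) borel (allocation_of T \<omega>) = lt_mix \<nu> \<omega>"
      by eventually_elim simp
  next
    assume "AE \<omega> in P. distr (lt0 \<omega>) borel (allocation_of T \<omega>) = lt_mix \<nu> \<omega>"
    with lt0 mix show "AE \<omega> in P. distr (l 0 \<omega>) borel (allocation_of T \<omega>) = local_time_mix l \<nu> \<omega>"
      by eventually_elim simp
  qed
  then show ?thesis
    using shifted_law_eq_of_transported transported_eq_of_shifted_law by blast
qed

text \<open>Covariance holds for every path, since shifting by \<open>t\<close> and then by
  \<open>s - t\<close> is shifting by \<open>s\<close>.\<close>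

lemma allocation_rule_allocation_of: "allocation_rule P (allocation_of T)"
  unfolding allocation_rule_def
  using measurable_allocation_of by (simp add: case_prod_beta' allocation_of_def)

end

end

theorem theorem1p2:
  fixes P0 :: "(real \<Rightarrow> real) measure"
    and l :: "real \<Rightarrow> (real \<Rightarrow> real) \<Rightarrow> real measure"
    and T :: "(real \<Rightarrow> real) \<Rightarrow> real"
    and \<nu> :: "real measure"
  assumes "brownian_law P0"
    and "local_time P0 l"
    and "random_time T"
    and "prob_space \<nu>" and "sets \<nu> = sets borel"
  shows "allocation_rule (stationary_law P0) (allocation_of T) \<and>
    (unbiased_shift P0 T \<and> embeds P0 T \<nu> \<longleftrightarrow>
       balances (stationary_law P0) (allocation_of T) (l 0) (local_time_mix l \<nu>))"
proof -
  interpret BM_local_time P0 l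
    using assms(1,2) by (simp add: BM_local_time_def canonical_BM_def BM_local_time_axioms_def)
  have T: "T \<in> borel_measurable path_space"
    using assms(3) by (simp add: random_time_def)
  show ?thesis
    using allocation_rule_allocation_of[OF T assms(4,5)] balances_iff[OF T assms(4,5)]
      unbiased_shift_embeds_iff[OF T assms(4,5)] by simp
qed

end
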